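(* Let $0<\epsilon<1/384$ and let $I:M_\lambda\to\mathbb{R}^3$ be a paper Moebius band with image $\Omega=I(M_\lambda)$ and $\lambda<\sqrt3+\epsilon$. Then there is a solid equilateral triangle in $\mathbb{R}^3$ of perimeter $2\sqrt3$ whose Hausdorff distance to $\Omega$ is at most $18\sqrt\epsilon$.
   Context: For $\lambda>0$, $M_\lambda$ is the flat Moebius band obtained from a $1\times\lambda$ rectangle by identifying its length-$1$ sides with a flip; equivalently, the quotient of the strip $\mathbb{R}\times[0,1]$ by the group generated by $(x,y)\mapsto(x+\lambda,1-y)$. A paper Moebius band (short for smooth embedded paper Moebius band) of aspect ratio $\lambda$ is an infinitely differentiable isometric embedding $I:M_\lambda\to\mathbb{R}^3$ (isometric in the Riemannian sense). A solid triangle is the (planar) convex hull of its three vertices. The Hausdorff distance between two compact subsets of $\mathbb{R}^3$ is the minimal $r$ such that each set is contained in the (closed) $r$-tubular neighborhood of the other. *)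

theory Defs
  imports "HOL-Analysis.Analysis"
begin

section \<open>The flat Moebius band\<close>

definition strip :: "(real \<times> real) set" where
  "strip = UNIV \<times> {0..1}"

definition glide :: "real \<Rightarrow> real \<times> real \<Rightarrow> real \<times> real" where
  "glide l = (\<lambda>(x, y). (x + l, 1 - y))"

text \<open>The group generated by the glide reflection is cyclic, so two points lie in the same
  orbit iff a nonnegative iterate of the generator maps one of them to the other.\<close>

definition orbit_rel :: "real \<Rightarrow> ((real \<times> real) \<times> (real \<times> real)) set" where
  "orbit_rel l = {(p, q). p \<in> strip \<and> q \<in> strip \<and>
     (\<exists>n. q = (glide l ^^ n) p \<or> p = (glide l ^^ n) q)}"

text \<open>The points of the band are the orbits themselves.\<close>

definition moebius_band :: "real \<Rightarrow> (real \<times> real) set set" where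
  "moebius_band l = strip // orbit_rel l"

definition moebius_proj :: "real \<Rightarrow> real \<times> real \<Rightarrow> (real \<times> real) set" where
  "moebius_proj l p = orbit_rel l `` {p}"

definition moebius_top :: "real \<Rightarrow> (real \<times> real) set topology" where
  "moebius_top l = topology (\<lambda>U. U \<subseteq> moebius_band l \<and>
     openin (top_of_set strip) {p \<in> strip. moebius_proj l p \<in> U})"

lemma moebius_band_eq: "moebius_band l = moebius_proj l ` strip"
  by (auto simp: moebius_band_def moebius_proj_def quotient_def)

lemma openin_moebius_top:
  "openin (moebius_top l) U \<longleftrightarrow> U \<subseteq> moebius_band l \<and>
     openin (top_of_set strip) {p \<in> strip. moebius_proj l p \<in> U}"
proof -
  have "istopology (\<lambda>U. U \<subseteq> moebius_band l \<and>
     openin (top_of_set strip) {p \<in> strip. moebius_proj l p \<in> U})" (is "istopology ?L")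
    unfolding istopology_def
  proof (intro conjI allI impI)
    fix S T assume "?L S" "?L T"
    moreover have "{p \<in> strip. moebius_proj l p \<in> S \<inter> T} =
      {p \<in> strip. moebius_proj l p \<in> S} \<inter> {p \<in> strip. moebius_proj l p \<in> T}" by auto
    ultimately show "S \<inter> T \<subseteq> moebius_band l"
      "openin (top_of_set strip) {p \<in> strip. moebius_proj l p \<in> S \<inter> T}"
      by (auto intro: openin_Int)
  next
    fix K assume K: "\<forall>S\<in>K. ?L S"
    then show "\<Union>K \<subseteq> moebius_band l" by blast
    have "{p \<in> strip. moebius_proj l p \<in> \<Union>K} =
      (\<Union>S\<in>K. {p \<in> strip. moebius_proj l p \<in> S})" by auto
    then show "openin (top_of_set strip) {p \<in> strip. moebius_proj l p \<in> \<Union>K}"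
      using K by (auto intro: openin_Union)
  qed
  then show ?thesis
    by (simp add: moebius_top_def topology_inverse')
qed

lemma topspace_moebius_top [simp]: "topspace (moebius_top l) = moebius_band l"
proof
  show "topspace (moebius_top l) \<subseteq> moebius_band l"
    using openin_moebius_top openin_topspace by blast
  have "{p \<in> strip. moebius_proj l p \<in> moebius_band l} = strip"
    by (auto simp: moebius_band_eq)
  then have "openin (moebius_top l) (moebius_band l)"
    by (simp add: openin_moebius_top)
  then show "moebius_band l \<subseteq> topspace (moebius_top l)"
    by (rule openin_subset)
qed

lemma quotient_map_moebius_proj:
  "quotient_map (top_of_set strip) (moebius_top l) (moebius_proj l)"
  by (auto simp: quotient_map_def openin_moebius_top moebius_band_eq)

section \<open>Smoothness\<close>

text \<open>Meaningful for open sets only, where \<open>Ck_on n f U\<close> says that \<open>f\<close> is of class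
  \<open>C\<^sup>n\<close> on \<open>U\<close>.\<close>

primrec Ck_on ::
  "nat \<Rightarrow> ('a::euclidean_space \<Rightarrow> 'b::euclidean_space) \<Rightarrow> 'a set \<Rightarrow> bool" where
  "Ck_on 0 f U \<longleftrightarrow> continuous_on U f"
| "Ck_on (Suc n) f U \<longleftrightarrow> f differentiable_on U \<and>
     (\<forall>v. Ck_on n (\<lambda>p. frechet_derivative f (at p) v) U)"

text \<open>On a set that is not open, smoothness means local smooth extendability. For the closed
  strip this is the usual notion of smoothness up to the boundary.\<close>

definition smooth_on :: "'a::euclidean_space set \<Rightarrow> ('a \<Rightarrow> 'b::euclidean_space) \<Rightarrow> bool" where
  "smooth_on S f \<longleftrightarrow> (\<forall>p\<in>S. \<exists>U g. open U \<and> p \<in> U \<and>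
     (\<forall>n. Ck_on n g U) \<and> (\<forall>q\<in>S \<inter> U. g q = f q))"

section \<open>Paper Moebius bands\<close>

text \<open>The projection from the strip is a local isometry defining both the smooth structure and
  the metric of the band, so smoothness and preservation of the Riemannian metric are expressed
  on the lift \<open>I \<circ> moebius_proj l\<close>. Its derivative within the strip is unique, also at
  boundary points. Metric preservation makes the differential injective, so together with
  \<open>embedding_map\<close> the map is a smooth embedding.\<close>

definition riemannian_isometric_on :: "(real \<times> real) set \<Rightarrow> (real \<times> real \<Rightarrow> real ^ 3) \<Rightarrow> bool" where
  "riemannian_isometric_on S f \<longleftrightarrow> (\<forall>p\<in>S. \<exists>D. (f has_derivative D) (at p within S) \<and>
     (\<forall>v w. D v \<bullet> D w = v \<bullet> w))"

definition paper_moebius_band :: "real \<Rightarrow> ((real \<times> real) set \<Rightarrow> real ^ 3) \<Rightarrow> bool" where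
  "paper_moebius_band l I \<longleftrightarrow> 0 < l \<and>
     embedding_map (moebius_top l) euclidean I \<and>
     smooth_on strip (I \<circ> moebius_proj l) \<and>
     riemannian_isometric_on strip (I \<circ> moebius_proj l)"

section \<open>Hausdorff distance and equilateral triangles\<close>

definition closed_tube :: "'a::metric_space set \<Rightarrow> real \<Rightarrow> 'a set" where
  "closed_tube A r = (\<Union>a\<in>A. cball a r)"

text \<open>Used for nonempty compact sets only, where the infimum is a minimum.\<close>

definition hausdorff_distance :: "'a::metric_space set \<Rightarrow> 'a set \<Rightarrow> real" where
  "hausdorff_distance A B = Inf {r. 0 \<le> r \<and> A \<subseteq> closed_tube B r \<and> B \<subseteq> closed_tube A r}"

lemma closed_tube_iff_infdist:
  fixes A :: "'a::heine_borel set"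
  assumes "compact A" "A \<noteq> {}"
  shows "x \<in> closed_tube A r \<longleftrightarrow> infdist x A \<le> r"
proof
  assume "x \<in> closed_tube A r"
  then obtain a where "a \<in> A" "dist x a \<le> r"
    by (auto simp: closed_tube_def dist_commute)
  then show "infdist x A \<le> r"
    using infdist_le2 by blast
next
  assume "infdist x A \<le> r"
  moreover obtain a where "a \<in> A" "infdist x A = dist x a"
    using infdist_attains_inf[of A x] assms compact_imp_closed by blast
  ultimately show "x \<in> closed_tube A r"
    by (auto simp: closed_tube_def dist_commute)
qed

lemma hausdorff_distance_attained:
  fixes A B :: "'a::heine_borel set"
  assumes "compact A" "A \<noteq> {}" "compact B" "B \<noteq> {}"
  shows "A \<subseteq> closed_tube B (hausdorff_distance A B)"
    and "B \<subseteq> closed_tube A (hausdorff_distance A B)"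
proof -
  let ?R = "{r. 0 \<le> r \<and> A \<subseteq> closed_tube B r \<and> B \<subseteq> closed_tube A r}"
  have R: "?R = {r. 0 \<le> r \<and> (\<forall>a\<in>A. infdist a B \<le> r) \<and> (\<forall>b\<in>B. infdist b A \<le> r)}"
    using assms by (auto simp: subset_iff closed_tube_iff_infdist)
  have "bounded (A \<union> B)"
    using assms by (simp add: compact_imp_bounded)
  then obtain d where d: "\<And>x y. x \<in> A \<union> B \<Longrightarrow> y \<in> A \<union> B \<Longrightarrow> dist x y \<le> d"
    using bounded_two_points by metis
  obtain a b where ab: "a \<in> A" "b \<in> B" using assms by auto
  have "0 \<le> d" using order_trans[OF zero_le_dist d[of a b]] ab by auto
  moreover have "infdist x B \<le> d" if "x \<in> A" for x
    using infdist_le2[of b B x d] d[of x b] ab that by auto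
  moreover have "infdist x A \<le> d" if "x \<in> B" for x
    using infdist_le2[of a A x d] d[of x a] ab that by auto
  ultimately have ne: "?R \<noteq> {}" unfolding R by blast
  have "infdist x B \<le> Inf ?R" if "x \<in> A" for x
    by (rule cInf_greatest[OF ne]) (use that R in auto)
  then show "A \<subseteq> closed_tube B (hausdorff_distance A B)"
    using closed_tube_iff_infdist[OF assms(3,4)] by (auto simp only: hausdorff_distance_def subset_iff)
  have "infdist x A \<le> Inf ?R" if "x \<in> B" for x
    by (rule cInf_greatest[OF ne]) (use that R in auto)
  then show "B \<subseteq> closed_tube A (hausdorff_distance A B)"
    using closed_tube_iff_infdist[OF assms(1,2)] by (auto simp only: hausdorff_distance_def subset_iff)
qed

definition equilateral_triangle :: "real \<Rightarrow> 'a::euclidean_space set \<Rightarrow> bool" where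
  "equilateral_triangle P T \<longleftrightarrow> (\<exists>a b c. T = convex hull {a, b, c} \<and>
     dist a b = dist b c \<and> dist b c = dist c a \<and> dist a b + dist b c + dist c a = P)"

end

theory Submission
  imports Defs
begin

text \<open>
The proof follows the bends of the band: the straight segments of the image that run from
boundary to boundary.

Lift the band to a map \<open>F\<close> of the strip. Since \<open>F\<close> is isometric, its second
derivatives are all normal to the surface, and the Gauss equation says that this normal-valued
symmetric form is degenerate. Where the form is nonzero it has a unique kernel direction, and
symmetry of the third derivatives forces the kernel to persist, with the form staying nonzero,
along the whole line in that direction (\<open>hess_propagates\<close>). Such a line cannot be horizontal,
because horizontal lines are periodic, so it is a chord of the strip, here called a ruling, which
\<open>F\<close> maps isometrically to a segment. Two rulings cannot cross, as the form would vanish at a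
crossing. Ordering chords by both of their ends, the rulings thus form a chain; a chord that is
comparable with every ruling but is not one meets none of them, so the second derivatives vanish
along it and it is straight too. Therefore the chain can be filled up to a continuous monotone
family of bends that is compatible with the glide reflection (\<open>bend_pos\<close>, \<open>bend_straight\<close>).

Going once around the band reverses the direction of a bend. If no two bends were perpendicular and
coplanar, the map that records the inner product of the directions of two bends and the volume that
measures their failure to be coplanar would avoid the origin of the plane on a triangle of
pairs of bends, although its symmetries give it a nonzero winding number along the sides
(\<open>triangle_zero\<close>, \<open>perpendicular_coplanar_bends\<close>). As the band is embedded, the two segments do
not cross, so one of them lies on one side of the line of the other (\<open>T_pattern\<close>).

Let \<open>PQ\<close> be the latter bend and \<open>V\<close> the end of the other bend that is farther from
its line, so the height of \<open>V\<close> is at least 1. If \<open>\<tau>\<close> is the horizontal offset of the ends of the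
bend \<open>PQ\<close> in the strip, its length is \<open>w = sqrt (1 + \<tau>\<^sup>2)\<close>, and it
divides the boundary, of total length \<open>2 * l\<close>, into one arc of length \<open>l - \<tau>\<close> from \<open>Q\<close> to \<open>P\<close> and
one of length \<open>l + \<tau>\<close> from \<open>P\<close> through \<open>V\<close> to \<open>Q\<close>. Hence \<open>w \<le> l - \<tau>\<close> and
\<open>sqrt (w\<^sup>2 + 4) \<le> l + \<tau>\<close>. Together these force \<open>l \<ge> sqrt 3\<close>, with equality only when
\<open>PQV\<close> is equilateral of height 1. For \<open>l < sqrt 3 + \<epsilon>\<close>
the lengths exceed the distances by \<open>O(\<epsilon>)\<close>, so the boundary stays within \<open>O(sqrt \<epsilon>)\<close> of the
triangle \<open>PQV\<close>, which in turn is that close to an equilateral one (\<open>trapezoid_estimates\<close>). The bends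
are segments between boundary points, so they stay near the convex triangle, and in sweeping from
\<open>PQ\<close> around to \<open>QP\<close> they come near each of its points (\<open>surface_near_triangle\<close>).
\<close>

section \<open>Directional derivatives of smooth maps\<close>

definition dderiv :: "'a::euclidean_space \<Rightarrow> ('a \<Rightarrow> 'b::euclidean_space) \<Rightarrow> 'a \<Rightarrow> 'b" where
  "dderiv v f p = frechet_derivative f (at p) v"

definition smooth_in :: "'a::euclidean_space set \<Rightarrow> ('a \<Rightarrow> 'b::euclidean_space) \<Rightarrow> bool" where
  "smooth_in U f \<longleftrightarrow> (\<forall>n. Ck_on n f U)"

lemma smooth_in_differentiable_on: "smooth_in U f \<Longrightarrow> f differentiable_on U"
  unfolding smooth_in_def by (metis Ck_on.simps(2))

lemma smooth_in_dderiv: "smooth_in U f \<Longrightarrow> smooth_in U (dderiv v f)"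
  unfolding smooth_in_def dderiv_def [abs_def] by (metis Ck_on.simps(2))

lemma has_derivative_dderiv:
  assumes "open U" "smooth_in U f" "p \<in> U"
  shows "(f has_derivative (\<lambda>v. dderiv v f p)) (at p)"
proof -
  have "f differentiable (at p)"
    using smooth_in_differentiable_on[OF assms(2)] assms(1,3)
    by (simp add: differentiable_on_eq_differentiable_at)
  then show ?thesis
    by (simp add: dderiv_def frechet_derivative_works)
qed

lemma dderiv_unique: "(f has_derivative D) (at p) \<Longrightarrow> dderiv v f p = D v"
  unfolding dderiv_def by (metis frechet_derivative_at)

lemma linear_dderiv:
  assumes "open U" "smooth_in U f" "p \<in> U"
  shows "linear (\<lambda>v. dderiv v f p)"
  using has_derivative_dderiv[OF assms] has_derivative_linear by blast

lemma continuous_on_smooth_in: "smooth_in U f \<Longrightarrow> continuous_on U f"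
  using smooth_in_differentiable_on differentiable_imp_continuous_on by blast

lemma continuous_on_dderiv: "smooth_in U f \<Longrightarrow> continuous_on U (dderiv v f)"
  by (intro continuous_on_smooth_in smooth_in_dderiv)

lemma has_vector_derivative_line:
  fixes f :: "'a::euclidean_space \<Rightarrow> 'b::euclidean_space"
  assumes "open U" "smooth_in U f" "p + t *\<^sub>R v \<in> U"
  shows "((\<lambda>t. f (p + t *\<^sub>R v)) has_vector_derivative dderiv v f (p + t *\<^sub>R v)) (at t)"
proof -
  have 1: "((\<lambda>t. p + t *\<^sub>R v) has_vector_derivative v) (at t)"
    by (auto intro!: derivative_eq_intros)
  have "(f has_derivative (\<lambda>w. dderiv w f (p + t *\<^sub>R v))) (at (p + t *\<^sub>R v) within range (\<lambda>t. p + t *\<^sub>R v))"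
    using has_derivative_dderiv[OF assms] has_derivative_at_withinI by blast
  from vector_derivative_diff_chain_within[OF 1 this]
  show ?thesis by (simp add: o_def)
qed

lemma has_real_derivative_line:
  fixes f :: "'a::euclidean_space \<Rightarrow> 'b::euclidean_space"
  assumes "open U" "smooth_in U f" "p + t *\<^sub>R v \<in> U"
  shows "((\<lambda>t. f (p + t *\<^sub>R v) \<bullet> a) has_real_derivative dderiv v f (p + t *\<^sub>R v) \<bullet> a) (at t)"
proof -
  have "((\<lambda>t. f (p + t *\<^sub>R v) \<bullet> a) has_vector_derivative dderiv v f (p + t *\<^sub>R v) \<bullet> a) (at t)"
    using has_vector_derivative_line[OF assms]
    by (rule bounded_linear.has_vector_derivative[OF bounded_linear_inner_left])
  then show ?thesis by (simp add: has_real_derivative_iff_has_vector_derivative)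
qed

lemma dderiv_inner:
  assumes "open U" "smooth_in U f" "smooth_in U g" "p \<in> U"
  shows "dderiv v (\<lambda>q. f q \<bullet> g q) p = dderiv v f p \<bullet> g p + f p \<bullet> dderiv v g p"
  by (subst dderiv_unique[OF has_derivative_inner[OF has_derivative_dderiv[OF assms(1,2,4)]
          has_derivative_dderiv[OF assms(1,3,4)]]]) simp

lemma dderiv_inner_const:
  assumes "open U" "smooth_in U f" "smooth_in U g" "p \<in> U" "\<And>q. q \<in> U \<Longrightarrow> f q \<bullet> g q = c"
  shows "dderiv v f p \<bullet> g p + f p \<bullet> dderiv v g p = 0"
proof -
  have "((\<lambda>q. f q \<bullet> g q) has_derivative (\<lambda>v. 0)) (at p)"
    by (rule has_derivative_transform_within_open[OF has_derivative_const assms(1,4)]) (simp add: assms(5))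
  then have "dderiv v (\<lambda>q. f q \<bullet> g q) p = 0" by (rule dderiv_unique)
  then show ?thesis by (simp add: dderiv_inner[OF assms(1-4)])
qed

text \<open>Two applications of the mean value theorem. The second difference on the left is symmetric in \<open>v\<close>
and \<open>w\<close>, which is why comparing the two ways to evaluate it makes the mixed derivatives agree.\<close>

lemma second_difference_mvt:
  fixes f :: "'a::euclidean_space \<Rightarrow> 'b::euclidean_space"
  assumes U: "open U" "smooth_in U f" and h: "0 < h"
    and sub: "\<And>s t. \<lbrakk>0 \<le> s; s \<le> h; 0 \<le> t; t \<le> h\<rbrakk> \<Longrightarrow> p + s *\<^sub>R v + t *\<^sub>R w \<in> U"
  shows "\<exists>s t. 0 \<le> s \<and> s \<le> h \<and> 0 \<le> t \<and> t \<le> h \<and>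
    (f (p + h *\<^sub>R v + h *\<^sub>R w) - f (p + h *\<^sub>R v) - f (p + h *\<^sub>R w) + f p) \<bullet> a
      = h * h * (dderiv w (dderiv v f) (p + s *\<^sub>R v + t *\<^sub>R w) \<bullet> a)"
proof -
  let ?G = "\<lambda>s. f ((p + h *\<^sub>R w) + s *\<^sub>R v) \<bullet> a - f (p + s *\<^sub>R v) \<bullet> a"
  let ?G' = "\<lambda>s. dderiv v f ((p + h *\<^sub>R w) + s *\<^sub>R v) \<bullet> a - dderiv v f (p + s *\<^sub>R v) \<bullet> a"
  have "(?G has_real_derivative ?G' s) (at s)" if "0 \<le> s" "s \<le> h" for s
    using sub[OF that, of h] sub[OF that, of 0] h
    by (intro DERIV_diff has_real_derivative_line[OF U]) (auto simp: algebra_simps)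
  from MVT2[OF h this] obtain s where s: "0 < s" "s < h" "?G h - ?G 0 = h * ?G' s"
    by auto
  have "((\<lambda>t. dderiv v f ((p + s *\<^sub>R v) + t *\<^sub>R w) \<bullet> a) has_real_derivative
      dderiv w (dderiv v f) ((p + s *\<^sub>R v) + t *\<^sub>R w) \<bullet> a) (at t)" if "0 \<le> t" "t \<le> h" for t
    using s that by (intro has_real_derivative_line[OF U(1)] smooth_in_dderiv U sub) auto
  from MVT2[OF h this] obtain t where t: "0 < t" "t < h"
    "dderiv v f ((p + s *\<^sub>R v) + h *\<^sub>R w) \<bullet> a - dderiv v f ((p + s *\<^sub>R v) + 0 *\<^sub>R w) \<bullet> a
      = h * (dderiv w (dderiv v f) ((p + s *\<^sub>R v) + t *\<^sub>R w) \<bullet> a)"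
    by auto
  have "?G' s = h * (dderiv w (dderiv v f) ((p + s *\<^sub>R v) + t *\<^sub>R w) \<bullet> a)"
    using t(3) by (simp add: algebra_simps)
  with s have "?G h - ?G 0 = h * h * (dderiv w (dderiv v f) ((p + s *\<^sub>R v) + t *\<^sub>R w) \<bullet> a)"
    by simp
  moreover have "?G h - ?G 0 = (f (p + h *\<^sub>R v + h *\<^sub>R w) - f (p + h *\<^sub>R v) - f (p + h *\<^sub>R w) + f p) \<bullet> a"
    by (simp add: algebra_simps)
  ultimately show ?thesis using s t by (metis less_imp_le)
qed

lemma dderiv_commute:
  fixes f :: "'a::euclidean_space \<Rightarrow> 'b::euclidean_space"
  assumes U: "open U" "smooth_in U f" "p \<in> U"
  shows "dderiv w (dderiv v f) p = dderiv v (dderiv w f) p"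
proof (rule vector_eq_ldot[THEN iffD1], rule allI)
  fix a
  let ?A = "\<lambda>q. dderiv w (dderiv v f) q \<bullet> a" and ?B = "\<lambda>q. dderiv v (dderiv w f) q \<bullet> a"
  have "?A p = ?B p"
  proof (rule ccontr)
    assume neq: "?A p \<noteq> ?B p"
    let ?e = "dist (?A p) (?B p) / 2"
    have e: "0 < ?e" using neq by simp
    have cont: "continuous_on U ?A" "continuous_on U ?B"
      by (intro continuous_intros continuous_on_dderiv smooth_in_dderiv U)+
    obtain d1 where d1: "d1 > 0" "\<And>q. q \<in> U \<Longrightarrow> dist q p < d1 \<Longrightarrow> dist (?A q) (?A p) < ?e"
      using cont(1) U(3) e unfolding continuous_on_iff by meson
    obtain d2 where d2: "d2 > 0" "\<And>q. q \<in> U \<Longrightarrow> dist q p < d2 \<Longrightarrow> dist (?B q) (?B p) < ?e"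
      using cont(2) U(3) e unfolding continuous_on_iff by meson
    obtain d3 where d3: "d3 > 0" "ball p d3 \<subseteq> U" using U openE by metis
    define d where "d = min d1 (min d2 d3)"
    have d: "d > 0" using d1 d2 d3 by (simp add: d_def)
    \<comment> \<open>The denominator keeps all points of the parallelogram of size \<open>h\<close> within distance \<open>d\<close> of \<open>p\<close>.\<close>
    define h where "h = d / (2 * (norm v + norm w + 1))"
    have h: "h > 0" using d unfolding h_def by (intro divide_pos_pos) (auto intro: add_nonneg_pos)
    have near: "dist (p + s *\<^sub>R v + t *\<^sub>R w) p < d" if "0 \<le> s" "s \<le> h" "0 \<le> t" "t \<le> h" for s t
    proof -
      have "dist (p + s *\<^sub>R v + t *\<^sub>R w) p = norm (s *\<^sub>R v + t *\<^sub>R w)"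
        by (simp add: dist_norm algebra_simps)
      also have "\<dots> \<le> s * norm v + t * norm w"
        using that by (intro norm_triangle_le) simp
      also have "\<dots> \<le> h * norm v + h * norm w"
        using that by (intro add_mono mult_right_mono) auto
      also have "\<dots> \<le> h * (norm v + norm w + 1)" using h by (simp add: algebra_simps)
      also have "\<dots> = d / 2"
        unfolding h_def using add_nonneg_pos[of "norm v + norm w" 1] by (simp add: field_simps)
      also have "\<dots> < d" using d by simp
      finally show ?thesis .
    qed
    have inU: "p + s *\<^sub>R v + t *\<^sub>R w \<in> U" if "0 \<le> s" "s \<le> h" "0 \<le> t" "t \<le> h" for s t
      using near[OF that] d3(2) by (auto simp: d_def dist_commute)
    obtain s t where st: "0 \<le> s" "s \<le> h" "0 \<le> t" "t \<le> h"
      "(f (p + h *\<^sub>R v + h *\<^sub>R w) - f (p + h *\<^sub>R v) - f (p + h *\<^sub>R w) + f p) \<bullet> a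
      = h * h * ?A (p + s *\<^sub>R v + t *\<^sub>R w)"
      using second_difference_mvt[OF U(1,2) h inU] by blast
    have inU': "p + s *\<^sub>R w + t *\<^sub>R v \<in> U" if "0 \<le> s" "s \<le> h" "0 \<le> t" "t \<le> h" for s t
      using inU[OF that(3,4,1,2)] by (simp add: algebra_simps)
    obtain s' t' where st': "0 \<le> s'" "s' \<le> h" "0 \<le> t'" "t' \<le> h"
      "(f (p + h *\<^sub>R w + h *\<^sub>R v) - f (p + h *\<^sub>R w) - f (p + h *\<^sub>R v) + f p) \<bullet> a
      = h * h * ?B (p + s' *\<^sub>R w + t' *\<^sub>R v)"
      using second_difference_mvt[OF U(1,2) h inU'] by blast
    let ?q = "p + s *\<^sub>R v + t *\<^sub>R w" and ?q' = "p + t' *\<^sub>R v + s' *\<^sub>R w"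
    have "?A ?q = ?B ?q'" using st(5) st'(5) h by (simp add: algebra_simps)
    moreover have "dist (?A ?q) (?A p) < ?e"
      using st near[of s t] by (intro d1 inU) (auto simp: d_def)
    moreover have "dist (?B ?q') (?B p) < ?e"
      using st' near[of t' s'] by (intro d2 inU) (auto simp: d_def)
    ultimately show False
      using dist_triangle_half_r[of "?A ?q" "?A p" "dist (?A p) (?B p)" "?B p"] by simp
  qed
  then show "a \<bullet> dderiv w (dderiv v f) p = a \<bullet> dderiv v (dderiv w f) p"
    by (simp add: inner_commute)
qed

lemma Ck_on_cong:
  assumes "open U" "\<And>p. p \<in> U \<Longrightarrow> f p = g p" "Ck_on n f U"
  shows "Ck_on n g U"
  using assms(2,3)
proof (induction n arbitrary: f g)
  case 0
  then show ?case by (simp cong: continuous_on_cong)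
next
  case (Suc n)
  have eq: "frechet_derivative f (at p) v = frechet_derivative g (at p) v" if "p \<in> U" for p v
  proof -
    have "f differentiable at p"
      using Suc.prems that assms(1) by (simp add: differentiable_on_eq_differentiable_at)
    then show ?thesis
      using frechet_derivative_transform_within_open[of f p U g] Suc.prems that assms(1) by metis
  qed
  have "g differentiable_on U"
    using Suc.prems assms(1) differentiable_transform_within[of f _ U 1 g]
    by (auto simp: differentiable_on_def)
  then show ?case
    using Suc.IH[OF eq] Suc.prems by auto
qed

lemma Ck_on_local:
  assumes "open S" "\<And>p. p \<in> S \<Longrightarrow> \<exists>U. open U \<and> p \<in> U \<and> Ck_on n f U"
  shows "Ck_on n f S"
  using assms(2)
proof (induction n arbitrary: f)
  case 0
  have "continuous (at p) f" if "p \<in> S" for p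
    using 0[OF that] by (auto simp: continuous_on_eq_continuous_at)
  then show ?case by (simp add: continuous_at_imp_continuous_on)
next
  case (Suc n)
  have "f differentiable (at p)" if "p \<in> S" for p
    using Suc.prems[OF that] by (auto simp: differentiable_on_eq_differentiable_at)
  then have "f differentiable_on S" by (simp add: differentiable_at_imp_differentiable_on)
  moreover have "Ck_on n (\<lambda>p. frechet_derivative f (at p) v) S" for v
    by (rule Suc.IH) (use Suc.prems in auto)
  ultimately show ?case by simp
qed

lemma Ck_on_subset: "Ck_on n f U \<Longrightarrow> V \<subseteq> U \<Longrightarrow> Ck_on n f V"
  by (induction n arbitrary: f) (auto intro: continuous_on_subset differentiable_on_subset)

lemma smooth_on_imp_smooth_in:
  assumes "open U" "U \<subseteq> S" "smooth_on S f"
  shows "smooth_in U f"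
  unfolding smooth_in_def
proof
  fix n
  show "Ck_on n f U"
  proof (rule Ck_on_local[OF assms(1)])
    fix p assume "p \<in> U"
    then obtain V g where V: "open V" "p \<in> V" "\<And>n. Ck_on n g V" "\<And>q. q \<in> S \<inter> V \<Longrightarrow> g q = f q"
      using assms unfolding smooth_on_def by (meson subsetD)
    have "Ck_on n f (V \<inter> U)"
      by (rule Ck_on_cong[OF _ _ Ck_on_subset[OF V(3)]]) (use V assms in auto)
    then show "\<exists>V. open V \<and> p \<in> V \<and> Ck_on n f V"
      using V \<open>p \<in> U\<close> assms(1) by (intro exI[of _ "V \<inter> U"]) auto
  qed
qed

lemma dderiv_cong:
  assumes "open U" "smooth_in U f" "p \<in> U" "\<And>q. q \<in> U \<Longrightarrow> f q = g q"
  shows "dderiv v f p = dderiv v g p"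
proof -
  have "(g has_derivative (\<lambda>v. dderiv v f p)) (at p)"
    by (rule has_derivative_transform_within_open[OF has_derivative_dderiv[OF assms(1-3)] assms(1,3,4)])
  then show ?thesis by (simp add: dderiv_unique)
qed

lemma dderiv_inner_right:
  assumes "open U" "smooth_in U f" "p \<in> U"
  shows "dderiv v (\<lambda>q. f q \<bullet> a) p = dderiv v f p \<bullet> a"
  by (rule dderiv_unique[OF has_derivative_inner_left[OF has_derivative_dderiv[OF assms]]])

lemma smooth_in_inner_right:
  fixes f :: "'a::euclidean_space \<Rightarrow> 'b::euclidean_space"
  assumes "open U" "smooth_in U f"
  shows "smooth_in U (\<lambda>q. f q \<bullet> a)"
  unfolding smooth_in_def
proof
  fix n
  show "Ck_on n (\<lambda>q. f q \<bullet> a) U"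
    using assms(2)
  proof (induction n arbitrary: f)
    case 0
    then show ?case by (simp add: continuous_on_smooth_in continuous_on_inner)
  next
    case (Suc n)
    have "(\<lambda>q. f q \<bullet> a) differentiable_on U"
      using has_derivative_inner_left[OF has_derivative_dderiv[OF assms(1) Suc.prems]]
      by (intro differentiable_at_imp_differentiable_on) (auto simp: differentiable_def)
    moreover have "Ck_on n (\<lambda>p. frechet_derivative (\<lambda>q. f q \<bullet> a) (at p) v) U" for v
      by (rule Ck_on_cong[OF assms(1) _ Suc.IH[OF smooth_in_dderiv[OF Suc.prems, of v]]])
        (use dderiv_inner_right[OF assms(1) Suc.prems] in \<open>simp add: dderiv_def\<close>)
    ultimately show ?case by simp
  qed
qed

lemma derivative_zero_on_open:
  assumes "open U" "p \<in> U" "\<And>q. q \<in> U \<Longrightarrow> g q = 0" "(g has_derivative g') (at p)"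
  shows "g' v = 0"
proof -
  have "(g has_derivative (\<lambda>_. 0)) (at p)"
    by (rule has_derivative_transform_within_open[OF has_derivative_const assms(1,2)]) (simp add: assms(3))
  from has_derivative_unique[OF assms(4) this] show ?thesis by metis
qed

section \<open>Degenerate Hessians along a line\<close>

text \<open>Gronwall's argument: if \<open>M\<close> bounds \<open>k\<close>, then \<open>B\<^sup>2 * exp (- 2 * M * t)\<close> is nonincreasing, and it
starts at 0.\<close>

lemma linear_ode_zero:
  fixes B k :: "real \<Rightarrow> real"
  assumes "\<And>t. \<lbrakk>0 \<le> t; t \<le> s\<rbrakk> \<Longrightarrow> (B has_real_derivative k t * B t) (at t)"
    and "continuous_on {0..s} k" "B 0 = 0" "0 \<le> s"
  shows "B s = 0"
proof -
  obtain M where M: "\<And>t. \<lbrakk>0 \<le> t; t \<le> s\<rbrakk> \<Longrightarrow> k t \<le> M"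
  proof -
    have "bounded (k ` {0..s})"
      by (intro compact_imp_bounded compact_continuous_image assms(2) compact_Icc)
    then obtain M where "\<forall>x\<in>k ` {0..s}. norm x \<le> M" unfolding bounded_iff by blast
    then have "\<And>t. \<lbrakk>0 \<le> t; t \<le> s\<rbrakk> \<Longrightarrow> k t \<le> M"
      by (metis abs_le_D1 atLeastAtMost_iff image_eqI real_norm_def)
    then show ?thesis using that by blast
  qed
  let ?g = "\<lambda>t. (B t)\<^sup>2 * exp (- 2 * M * t)"
  have "?g s \<le> ?g 0"
  proof (rule DERIV_nonpos_imp_nonincreasing[OF assms(4)])
    fix t assume t: "0 \<le> t" "t \<le> s"
    have "(?g has_real_derivative 2 * (k t - M) * ((B t)\<^sup>2 * exp (- 2 * M * t))) (at t)"
      using assms(1)[OF t]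
      by (auto intro!: derivative_eq_intros simp: algebra_simps power2_eq_square)
    moreover have "2 * (k t - M) * ((B t)\<^sup>2 * exp (- 2 * M * t)) \<le> 0"
      using M[OF t] by (simp add: mult_nonpos_nonneg)
    ultimately show "\<exists>y. (?g has_real_derivative y) (at t) \<and> y \<le> 0" by blast
  qed
  then have "(B s)\<^sup>2 \<le> 0"
    using assms(3) by (simp add: mult_le_0_iff not_less exp_gt_zero[THEN less_imp_le, THEN leD])
  then show ?thesis by simp
qed

lemma constant_if_zero_derivative:
  fixes g :: "real \<Rightarrow> real"
  assumes "\<And>x. \<lbrakk>0 \<le> x; x < s\<rbrakk> \<Longrightarrow> (g has_real_derivative 0) (at x)" "0 \<le> t" "t < s"
  shows "g t = g 0"
proof -
  have "\<exists>c. \<forall>x\<in>{0..<s}. g x = c"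
    by (rule has_field_derivative_zero_constant) (auto intro: DERIV_subset assms(1))
  then show ?thesis using assms(2,3) by force
qed

text \<open>With \<open>C' = b\<close>, the equation \<open>b' = 2 * b\<^sup>2 / C\<close> says that \<open>1 / C\<close> has second derivative 0. An affine
function is bounded on a bounded interval, so \<open>C\<close> cannot tend to 0 at its end; this keeps a ruling
from stopping inside the strip.\<close>

lemma reciprocal_affine:
  fixes C b :: "real \<Rightarrow> real"
  assumes C: "\<And>t. \<lbrakk>0 \<le> t; t < s\<rbrakk> \<Longrightarrow> C t \<noteq> 0"
    and C': "\<And>t. \<lbrakk>0 \<le> t; t < s\<rbrakk> \<Longrightarrow> (C has_real_derivative b t) (at t)"
    and b': "\<And>t. \<lbrakk>0 \<le> t; t < s\<rbrakk> \<Longrightarrow> (b has_real_derivative 2 * (b t)\<^sup>2 / C t) (at t)"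
  obtains \<alpha> \<beta> where "\<And>t. \<lbrakk>0 \<le> t; t < s\<rbrakk> \<Longrightarrow> C t * (\<alpha> + \<beta> * t) = 1"
proof
  fix t assume t: "0 \<le> t" "t < s"
  let ?\<beta> = "- b 0 / (C 0)\<^sup>2"
  have slope: "b r / (C r)\<^sup>2 = b 0 / (C 0)\<^sup>2" if "0 \<le> r" "r < s" for r
  proof (rule constant_if_zero_derivative[of s "\<lambda>r. b r / (C r)\<^sup>2"])
    fix x assume x: "0 \<le> x" "x < s"
    show "((\<lambda>r. b r / (C r)\<^sup>2) has_real_derivative 0) (at x)"
      using C[OF x] C'[OF x] b'[OF x]
      by (auto intro!: derivative_eq_intros simp: power2_eq_square field_simps)
  qed (use that in auto)
  have "1 / C t - ?\<beta> * t = 1 / C 0 - ?\<beta> * 0"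
  proof (rule constant_if_zero_derivative[of s "\<lambda>r. 1 / C r - ?\<beta> * r"])
    fix x assume x: "0 \<le> x" "x < s"
    show "((\<lambda>r. 1 / C r - ?\<beta> * r) has_real_derivative 0) (at x)"
      using C[OF x] C[of 0] C'[OF x] slope[OF x] x
      by (auto intro!: derivative_eq_intros simp: power2_eq_square)
  qed (use t in auto)
  then show "C t * (1 / C 0 + ?\<beta> * t) = 1"
    using C[OF t] C[of 0] t by (simp add: field_simps)
qed

text \<open>Let \<open>A\<close>, \<open>B\<close>, \<open>C\<close> be the entries of the Hessian for the directions \<open>T\<close> and \<open>\<nu>\<close>, so that
\<open>A * C = B\<^sup>2\<close>. Symmetry of the third derivatives means that along the line in direction \<open>T\<close> the
derivative of \<open>B\<close> is the \<open>\<nu>\<close>-derivative of \<open>A\<close>, and that of \<open>C\<close> is the \<open>\<nu>\<close>-derivative of \<open>B\<close>.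
As long as \<open>C\<close> is nonzero, \<open>A = B\<^sup>2 / C\<close> turns the first into a homogeneous linear equation for \<open>B\<close>,
so \<open>B\<close> and \<open>A\<close> stay 0. Differentiating \<open>A * C = B\<^sup>2\<close> twice in direction \<open>\<nu>\<close> then shows that \<open>1 / C\<close> is
affine along the line, so there is no first zero of \<open>C\<close>.\<close>

lemma degenerate_hessian_propagates:
  fixes \<phi> :: "'a::euclidean_space \<Rightarrow> real"
  assumes U: "open U" "smooth_in U \<phi>"
    and degenerate: "\<And>q v w. q \<in> U \<Longrightarrow>
      dderiv v (dderiv v \<phi>) q * dderiv w (dderiv w \<phi>) q = (dderiv w (dderiv v \<phi>) q)\<^sup>2"
    and line: "\<And>t. \<lbrakk>0 \<le> t; t \<le> r\<rbrakk> \<Longrightarrow> p + t *\<^sub>R T \<in> U" "0 \<le> r"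
    and init: "dderiv T (dderiv T \<phi>) p = 0" "dderiv \<nu> (dderiv \<nu> \<phi>) p \<noteq> 0"
  shows "dderiv T (dderiv T \<phi>) (p + r *\<^sub>R T) = 0 \<and> dderiv \<nu> (dderiv \<nu> \<phi>) (p + r *\<^sub>R T) \<noteq> 0"
proof -
  define A where "A = dderiv T (dderiv T \<phi>)"
  define B where "B = dderiv \<nu> (dderiv T \<phi>)"
  define C where "C = dderiv \<nu> (dderiv \<nu> \<phi>)"
  define An where "An = dderiv \<nu> A"
  define Bn where "Bn = dderiv \<nu> B"
  define Cn where "Cn = dderiv \<nu> C"
  define L where "L t = p + t *\<^sub>R T" for t
  note smooth = U(2) smooth_in_dderiv
  have sm: "smooth_in U A" "smooth_in U B" "smooth_in U C" "smooth_in U An" "smooth_in U Bn" "smooth_in U Cn"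
    unfolding A_def B_def C_def An_def Bn_def Cn_def by (intro smooth)+
  note hd = has_derivative_dderiv[OF U(1)]
  have e0: "A q * C q = (B q)\<^sup>2" if "q \<in> U" for q
    using degenerate[OF that, of T \<nu>] by (simp add: A_def B_def C_def)
  \<comment> \<open>The first and second \<open>\<nu>\<close>-derivatives of \<open>A * C = B\<^sup>2\<close>; the suffix \<open>n\<close> marks \<open>\<nu>\<close>-derivatives.\<close>
  have e1: "An q * C q + A q * Cn q - 2 * B q * Bn q = 0" if q: "q \<in> U" for q
  proof -
    have "((\<lambda>q. A q * C q - (B q)\<^sup>2) has_derivative
        (\<lambda>v. dderiv v A q * C q + A q * dderiv v C q - 2 * B q * dderiv v B q)) (at q)"
      by (auto intro!: derivative_eq_intros hd sm q)
    from derivative_zero_on_open[OF U(1) q _ this, of \<nu>] e0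
    show ?thesis by (simp add: An_def Bn_def Cn_def)
  qed
  have e2: "dderiv \<nu> An q * C q = 2 * (Bn q)\<^sup>2" if q: "q \<in> U" and z: "A q = 0" "B q = 0" "An q = 0" for q
  proof -
    have "((\<lambda>q. An q * C q + A q * Cn q - 2 * B q * Bn q) has_derivative
        (\<lambda>v. (dderiv v An q * C q + An q * dderiv v C q) + (dderiv v A q * Cn q + A q * dderiv v Cn q)
          - (2 * dderiv v B q * Bn q + 2 * B q * dderiv v Bn q))) (at q)"
      by (auto intro!: derivative_eq_intros hd sm q)
    from derivative_zero_on_open[OF U(1) q _ this, of \<nu>] e1 z
    show ?thesis by (simp add: Bn_def An_def power2_eq_square)
  qed
  \<comment> \<open>Symmetry of the third derivatives, and of the fourth for \<open>Bn\<close>.\<close>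
  have BT: "dderiv T B q = An q" if "q \<in> U" for q
    unfolding B_def An_def A_def by (intro dderiv_commute[OF U(1)] smooth that)
  have CT: "dderiv T C q = Bn q" if "q \<in> U" for q
  proof -
    have "dderiv T C q = dderiv \<nu> (dderiv T (dderiv \<nu> \<phi>)) q"
      unfolding C_def by (intro dderiv_commute[OF U(1)] smooth that)
    also have "\<dots> = Bn q"
      unfolding Bn_def B_def
      by (intro dderiv_cong[OF U(1)] dderiv_commute[OF U(1)] smooth that)
    finally show ?thesis .
  qed
  have BnT: "dderiv T Bn q = dderiv \<nu> An q" if "q \<in> U" for q
  proof -
    have "dderiv T Bn q = dderiv \<nu> (dderiv T B) q"
      unfolding Bn_def by (intro dderiv_commute[OF U(1)] sm that)
    also have "\<dots> = dderiv \<nu> An q"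
      by (intro dderiv_cong[OF U(1)] smooth_in_dderiv sm that BT)
    finally show ?thesis .
  qed
  have der: "((\<lambda>t. g (L t)) has_real_derivative dderiv T g (L t)) (at t)"
    if "smooth_in U g" "0 \<le> t" "t \<le> r" for t and g :: "'a \<Rightarrow> real"
    using has_real_derivative_line[OF U(1) that(1) line(1)[OF that(2,3)], of 1] by (simp add: L_def)
  have LU: "L t \<in> U" if "0 \<le> t" "t \<le> r" for t using line that by (simp add: L_def)
  have contL: "continuous_on {0..s} (\<lambda>t. g (L t))" if "smooth_in U g" "s \<le> r" for s and g :: "'a \<Rightarrow> real"
    by (rule continuous_on_compose2[OF continuous_on_smooth_in[OF that(1)]])
      (auto simp: L_def[abs_def] that intro!: continuous_intros line(1) order_trans[OF _ that(2)])
  have B0: "B p = 0"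
    using e0[of p] init(1) line(1)[of 0] line(2) by (simp add: A_def)
  have B_zero: "B (L s) = 0" if s: "0 \<le> s" "s \<le> r" and nz: "\<And>t. \<lbrakk>0 \<le> t; t \<le> s\<rbrakk> \<Longrightarrow> C (L t) \<noteq> 0" for s
  proof -
    define k where "k t = (2 * Bn (L t) - B (L t) / C (L t) * Cn (L t)) / C (L t)" for t
    show ?thesis
    proof (rule linear_ode_zero[of s "\<lambda>t. B (L t)" k])
      fix t assume t: "0 \<le> t" "t \<le> s"
      have "An (L t) * C (L t) = 2 * B (L t) * Bn (L t) - A (L t) * Cn (L t)"
        using e1[OF LU, of t] t s by simp
      moreover have "A (L t) = B (L t) * B (L t) / C (L t)"
        using e0[OF LU, of t] t s nz[OF t] by (simp add: field_simps power2_eq_square)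
      ultimately have "An (L t) = k t * B (L t)"
        using nz[OF t] by (simp add: k_def field_simps)
      then show "((\<lambda>t. B (L t)) has_real_derivative k t * B (L t)) (at t)"
        using der[OF sm(2), of t] BT[OF LU, of t] t s by simp
    next
      show "continuous_on {0..s} k"
        unfolding k_def using nz by (intro continuous_intros contL sm s) auto
    qed (use B0 s in \<open>auto simp: L_def\<close>)
  qed
  have C_nz: "C (L t) \<noteq> 0" if t: "0 \<le> t" "t \<le> r" for t
  proof
    assume "C (L t) = 0"
    define Z where "Z = {t \<in> {0..r}. C (L t) = 0}"
    have "closed Z"
      unfolding Z_def using continuous_closed_preimage_constant[OF contL[OF sm(3) order_refl]] by simp
    moreover have "bounded Z" by (rule bounded_subset[of "{0..r}"]) (auto simp: Z_def)
    ultimately have "compact Z" by (simp add: compact_eq_bounded_closed)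
    moreover have "Z \<noteq> {}" using \<open>C (L t) = 0\<close> t by (auto simp: Z_def)
    ultimately obtain s where s: "s \<in> Z" "\<And>t. t \<in> Z \<Longrightarrow> s \<le> t"
      using compact_attains_inf by metis
    have sr: "0 \<le> s" "s \<le> r" "C (L s) = 0" using s(1) by (auto simp: Z_def)
    have nz: "C (L u) \<noteq> 0" if "0 \<le> u" "u < s" for u
      using s(2)[of u] that sr by (auto simp: Z_def)
    have spos: "0 < s" using sr init(2) by (cases "s = 0") (auto simp: L_def C_def)
    have "((\<lambda>t. C (L t)) has_real_derivative Bn (L u)) (at u)" if "0 \<le> u" "u < s" for u
      using der[OF sm(3), of u] CT[OF LU, of u] that sr by simp
    moreover have "((\<lambda>t. Bn (L t)) has_real_derivative 2 * (Bn (L u))\<^sup>2 / C (L u)) (at u)"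
      if u: "0 \<le> u" "u < s" for u
    proof -
      have B: "B (L u) = 0" using B_zero[of u] nz u sr by simp
      then have A: "A (L u) = 0" using e0[OF LU, of u] nz[OF u] u sr by simp
      have An: "An (L u) = 0" using e1[OF LU, of u] A B nz[OF u] u sr by simp
      have "dderiv T Bn (L u) = 2 * (Bn (L u))\<^sup>2 / C (L u)"
        using e2[OF LU _ _ An] BnT[OF LU, of u] A B nz[OF u] u sr by (simp add: field_simps)
      then show ?thesis using der[OF sm(5), of u] u sr by simp
    qed
    ultimately obtain \<alpha> \<beta> where ab: "\<And>u. \<lbrakk>0 \<le> u; u < s\<rbrakk> \<Longrightarrow> C (L u) * (\<alpha> + \<beta> * u) = 1"
      using reciprocal_affine[of s "\<lambda>t. C (L t)" "\<lambda>t. Bn (L t)"] nz by blast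
    have "isCont (\<lambda>t. C (L t)) s" using DERIV_isCont[OF der[OF sm(3)]] sr by blast
    then have "((\<lambda>t. C (L t)) \<longlongrightarrow> C (L s)) (at_left s)"
      by (simp add: isCont_def filterlim_at_split)
    then have "((\<lambda>u. C (L u) * (\<alpha> + \<beta> * u)) \<longlongrightarrow> C (L s) * (\<alpha> + \<beta> * s)) (at_left s)"
      by (intro tendsto_intros)
    moreover have "\<forall>\<^sub>F u in at_left s. C (L u) * (\<alpha> + \<beta> * u) = 1"
      using eventually_at_left_real[OF spos] by eventually_elim (use ab in auto)
    ultimately have "((\<lambda>u. 1::real) \<longlongrightarrow> C (L s) * (\<alpha> + \<beta> * s)) (at_left s)"
      using Lim_transform_eventually by fastforce
    then have "C (L s) * (\<alpha> + \<beta> * s) = 1"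
      using tendsto_unique[OF trivial_limit_at_left_real tendsto_const] by fastforce
    then show False using sr by simp
  qed
  have "B (L r) = 0" using B_zero[of r] C_nz line(2) by blast
  then have "A (L r) = 0" using e0[OF LU, of r] C_nz[of r] line(2) by simp
  then show ?thesis using C_nz[of r] line(2) by (simp add: A_def C_def L_def)
qed

section \<open>Flat immersions of plane domains\<close>

lemma parallel_to_cross:
  fixes e1 e2 x :: "real ^ 3"
  assumes "norm (cross3 e1 e2) = 1" "x \<bullet> e1 = 0" "x \<bullet> e2 = 0"
  shows "x = (x \<bullet> cross3 e1 e2) *\<^sub>R cross3 e1 e2"
proof -
  have "cross3 x (cross3 e1 e2) = 0"
    using assms(2,3) by (simp add: Lagrange)
  moreover have "cross3 n (cross3 x n) = (n \<bullet> n) *\<^sub>R x - (n \<bullet> x) *\<^sub>R n" for n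
    by (rule Lagrange)
  ultimately show ?thesis
    using assms(1) by (metis cross_zero_right dot_square_norm eq_iff_diff_eq_0 inner_commute one_power2 scaleR_one)
qed

locale flat_immersion =
  fixes U :: "(real \<times> real) set" and f :: "real \<times> real \<Rightarrow> real ^ 3"
  assumes open_U: "open U" and smooth: "smooth_in U f"
    and isometric: "\<And>p v w. p \<in> U \<Longrightarrow> dderiv v f p \<bullet> dderiv w f p = v \<bullet> w"
begin

text \<open>Values are vectors; \<open>hess_normal\<close> shows that they are normal to the surface, so this is the second
fundamental form times the unit normal.\<close>

definition hess :: "real \<times> real \<Rightarrow> real \<times> real \<Rightarrow> real \<times> real \<Rightarrow> real ^ 3" where
  "hess p v w = dderiv v (dderiv w f) p"

lemma hess_commute: "p \<in> U \<Longrightarrow> hess p v w = hess p w v"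
  unfolding hess_def by (rule dderiv_commute[OF open_U smooth])

lemma linear_hess_left: "p \<in> U \<Longrightarrow> linear (\<lambda>v. hess p v w)"
  unfolding hess_def by (rule linear_dderiv[OF open_U smooth_in_dderiv[OF smooth]])

lemma linear_hess_right: "p \<in> U \<Longrightarrow> linear (hess p v)"
  using linear_hess_left[of p v] hess_commute[of p v] by presburger

lemma hess_add_left: "p \<in> U \<Longrightarrow> hess p (v + v') w = hess p v w + hess p v' w"
  and hess_scale_left: "p \<in> U \<Longrightarrow> hess p (c *\<^sub>R v) w = c *\<^sub>R hess p v w"
  and hess_add_right: "p \<in> U \<Longrightarrow> hess p w (v + v') = hess p w v + hess p w v'"
  and hess_scale_right: "p \<in> U \<Longrightarrow> hess p w (c *\<^sub>R v) = c *\<^sub>R hess p w v"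
  using linear_add[OF linear_hess_left] linear_scale[OF linear_hess_left]
    linear_add[OF linear_hess_right] linear_scale[OF linear_hess_right] by blast+

text \<open>Constancy of the inner products of first derivatives makes \<open>hess p v w \<bullet> dderiv x f p\<close> skew in
\<open>w\<close> and \<open>x\<close>, while it is symmetric in \<open>v\<close> and \<open>w\<close>; a trilinear form with both properties is 0.\<close>

lemma hess_normal:
  assumes p: "p \<in> U"
  shows "hess p v w \<bullet> dderiv x f p = 0"
proof -
  have skew: "hess p v w \<bullet> dderiv x f p + hess p v x \<bullet> dderiv w f p = 0" for v w x
    using dderiv_inner_const[OF open_U smooth_in_dderiv[OF smooth] smooth_in_dderiv[OF smooth] p isometric, of v w x]
    by (simp add: hess_def inner_commute)
  show ?thesis
    using skew[of v w x] skew[of w v x] skew[of x v w]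
      hess_commute[OF p, of w v] hess_commute[OF p, of x v] hess_commute[OF p, of x w] by simp
qed

text \<open>Differentiating the normality of the second derivatives produces third derivatives, which cancel
by symmetry.\<close>

lemma gauss_equation:
  assumes p: "p \<in> U"
  shows "hess p v v \<bullet> hess p w w = hess p v w \<bullet> hess p v w"
proof -
  have sm: "smooth_in U (dderiv x f)" "smooth_in U (dderiv y (dderiv x f))" for x y
    by (intro smooth_in_dderiv smooth)+
  have *: "dderiv x (dderiv y (dderiv z f)) p \<bullet> dderiv w f p + hess p y z \<bullet> hess p x w = 0" for x y z
    using dderiv_inner_const[OF open_U sm(2) sm(1) p, of y z w 0 x] hess_normal by (simp add: hess_def)
  have "dderiv w (dderiv v (dderiv v f)) p = dderiv v (dderiv w (dderiv v f)) p"
    by (rule dderiv_commute[OF open_U sm(1) p])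
  then show ?thesis
    using *[of w v v] *[of v w v] hess_commute[OF p, of v w] by simp
qed

lemma hess_kernel: "p \<in> U \<Longrightarrow> hess p v v = 0 \<Longrightarrow> hess p v w = 0"
  using gauss_equation[of p v w] by simp

lemma hess_parallel:
  assumes p: "p \<in> U"
  obtains n where "n \<bullet> n = 1" "\<And>v w. hess p v w = (hess p v w \<bullet> n) *\<^sub>R n"
proof
  let ?e1 = "dderiv (1, 0) f p" and ?e2 = "dderiv (0, 1) f p"
  let ?n = "cross3 ?e1 ?e2"
  have "(norm ?n)\<^sup>2 = 1"
    using norm_cross_dot[of ?e1 ?e2] isometric[OF p]
    by (simp add: power_mult_distrib power2_norm_eq_inner)
  then have n: "norm ?n = 1" by (metis norm_ge_zero power2_eq_1_iff not_one_le_zero neg_0_le_iff_le)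
  then show "?n \<bullet> ?n = 1" by (simp add: dot_square_norm)
  show "hess p v w = (hess p v w \<bullet> ?n) *\<^sub>R ?n" for v w
    by (rule parallel_to_cross[OF n hess_normal[OF p] hess_normal[OF p]])
qed

lemma hess_component_degenerate:
  assumes p: "p \<in> U"
  shows "(hess p v v \<bullet> a) * (hess p w w \<bullet> a) = (hess p v w \<bullet> a)\<^sup>2"
proof -
  obtain n where n: "n \<bullet> n = 1" "\<And>v w. hess p v w = (hess p v w \<bullet> n) *\<^sub>R n"
    using hess_parallel[OF p] by blast
  define h where "h v w = hess p v w \<bullet> n" for v w
  have H: "hess p v w = h v w *\<^sub>R n" for v w using n(2)[of v w] by (simp add: h_def)
  have "h v v * h w w = (h v w)\<^sup>2"
    using gauss_equation[OF p, of v w] n(1) by (simp add: H power2_eq_square mult.commute)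
  then have "h v v * h w w * (n \<bullet> a)\<^sup>2 = (h v w)\<^sup>2 * (n \<bullet> a)\<^sup>2" by simp
  then show ?thesis by (simp only: H inner_scaleR_left power2_eq_square mult_ac)
qed

lemma hess_basis:
  assumes p: "p \<in> U" and "hess p (1,0) (1,0) = 0" "hess p (0,1) (0,1) = 0"
  shows "hess p v w = 0"
proof -
  have v: "v = fst v *\<^sub>R (1,0) + snd v *\<^sub>R (0,1)" for v :: "real \<times> real"
    by (simp add: prod_eq_iff)
  have "hess p (1,0) w = 0" "hess p (0,1) w = 0" for w
    using hess_kernel[OF p] assms(2,3) by auto
  then have "hess p (fst v *\<^sub>R (1,0) + snd v *\<^sub>R (0,1)) w = 0"
    by (simp only: hess_add_left[OF p] hess_scale_left[OF p]) simp
  then show ?thesis using v[of v] by metis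
qed

lemma hess_kernel_exists:
  assumes p: "p \<in> U"
  shows "\<exists>T. T \<noteq> 0 \<and> hess p T T = 0"
proof (cases "hess p (1,0) (1,0) = 0")
  case True
  then show ?thesis by (intro exI[of _ "(1,0)"]) (simp add: prod_eq_iff)
next
  case False
  obtain n where n: "n \<bullet> n = 1" "\<And>v w. hess p v w = (hess p v w \<bullet> n) *\<^sub>R n"
    using hess_parallel[OF p] by blast
  define h where "h v w = hess p v w \<bullet> n" for v w
  have H: "hess p v w = h v w *\<^sub>R n" for v w using n(2)[of v w] by (simp add: h_def)
  define e1 :: "real \<times> real" where "e1 = (1,0)"
  define e2 :: "real \<times> real" where "e2 = (0,1)"
  have A: "h e1 e1 \<noteq> 0" using False H[of e1 e1] by (auto simp: e1_def)
  \<comment> \<open>The second row of the adjugate of a singular matrix, here that of \<open>h\<close>, lies in its kernel.\<close>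
  define T where "T = (- h e1 e2) *\<^sub>R e1 + h e1 e1 *\<^sub>R e2"
  have AC: "h e1 e1 * h e2 e2 = (h e1 e2)\<^sup>2"
    using gauss_equation[OF p, of e1 e2] n(1) by (simp add: H power2_eq_square mult.commute)
  have quad: "hess p (x *\<^sub>R e1 + y *\<^sub>R e2) (x *\<^sub>R e1 + y *\<^sub>R e2) =
      x *\<^sub>R x *\<^sub>R hess p e1 e1 + (x * y) *\<^sub>R hess p e1 e2 + (x * y) *\<^sub>R hess p e1 e2 + y *\<^sub>R y *\<^sub>R hess p e2 e2" for x y
    by (simp only: hess_add_left[OF p] hess_scale_left[OF p] hess_add_right[OF p]
        hess_scale_right[OF p] hess_commute[OF p, of e2 e1]) (simp add: algebra_simps)
  have "hess p T T = ((h e1 e2)\<^sup>2 * h e1 e1 - 2 * h e1 e2 * h e1 e1 * h e1 e2 + (h e1 e1)\<^sup>2 * h e2 e2) *\<^sub>R n"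
    unfolding T_def by (simp only: quad H[of e1 e1] H[of e1 e2] H[of e2 e2])
      (simp add: scaleR_add_left[symmetric] power2_eq_square algebra_simps)
  also have "(h e1 e2)\<^sup>2 * h e1 e1 - 2 * h e1 e2 * h e1 e1 * h e1 e2 + (h e1 e1)\<^sup>2 * h e2 e2 = 0"
    using AC by (simp add: power2_eq_square algebra_simps)
  finally have "hess p T T = 0" by simp
  moreover have "T \<noteq> 0" using A by (simp add: T_def e1_def e2_def prod_eq_iff)
  ultimately show ?thesis by blast
qed

text \<open>The component of \<open>f\<close> along the curvature vector \<open>a\<close> at \<open>p\<close> has a degenerate Hessian to which the
scalar result applies. At the far end the \<open>a\<close>-component of \<open>hess\<close> in direction \<open>\<nu>\<close> is still
nonzero, so the normal there is not orthogonal to \<open>a\<close>, and a normal vector whose \<open>a\<close>-component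
vanishes is 0.\<close>

lemma hess_propagates_forward:
  assumes line: "\<And>t. \<lbrakk>0 \<le> t; t \<le> r\<rbrakk> \<Longrightarrow> p + t *\<^sub>R T \<in> U" "0 \<le> r"
    and init: "hess p T T = 0" "hess p \<nu> \<nu> \<noteq> 0"
  shows "hess (p + r *\<^sub>R T) T T = 0 \<and> hess (p + r *\<^sub>R T) \<nu> \<nu> \<noteq> 0"
proof -
  have p: "p \<in> U" using line(1)[of 0] line(2) by simp
  define a where "a = hess p \<nu> \<nu>"
  define \<phi> where "\<phi> = (\<lambda>q. f q \<bullet> a)"
  have sm: "smooth_in U \<phi>" unfolding \<phi>_def by (rule smooth_in_inner_right[OF open_U smooth])
  have d1: "dderiv w \<phi> q = dderiv w f q \<bullet> a" if "q \<in> U" for q w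
    unfolding \<phi>_def by (rule dderiv_inner_right[OF open_U smooth that])
  have d2: "dderiv v (dderiv w \<phi>) q = hess q v w \<bullet> a" if "q \<in> U" for q v w
  proof -
    have "dderiv v (dderiv w \<phi>) q = dderiv v (\<lambda>q. dderiv w f q \<bullet> a) q"
      by (intro dderiv_cong[OF open_U smooth_in_dderiv[OF sm] that d1])
    then show ?thesis
      by (simp add: dderiv_inner_right[OF open_U smooth_in_dderiv[OF smooth] that] hess_def)
  qed
  define q where "q = p + r *\<^sub>R T"
  have q: "q \<in> U" using line by (simp add: q_def)
  have "dderiv T (dderiv T \<phi>) q = 0 \<and> dderiv \<nu> (dderiv \<nu> \<phi>) q \<noteq> 0"
    unfolding q_def
  proof (rule degenerate_hessian_propagates[OF open_U sm _ line])
    fix q v w assume q: "q \<in> U"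
    show "dderiv v (dderiv v \<phi>) q * dderiv w (dderiv w \<phi>) q = (dderiv w (dderiv v \<phi>) q)\<^sup>2"
      using hess_component_degenerate[OF q, of v a w] hess_commute[OF q, of v w] by (simp add: d2[OF q])
  qed (use init d2[OF p] in \<open>auto simp: a_def\<close>)
  then have *: "hess q T T \<bullet> a = 0" "hess q \<nu> \<nu> \<bullet> a \<noteq> 0" by (simp_all add: d2[OF q])
  obtain n where n: "n \<bullet> n = 1" "\<And>v w. hess q v w = (hess q v w \<bullet> n) *\<^sub>R n"
    using hess_parallel[OF q] by blast
  have "n \<bullet> a \<noteq> 0" using * n(2)[of \<nu> \<nu>] by (metis inner_scaleR_left mult_zero_right)
  then have "hess q T T \<bullet> n = 0" using * n(2)[of T T] by (metis inner_scaleR_left mult_eq_0_iff)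
  then have "hess q T T = 0" using n(2)[of T T] by simp
  then show ?thesis using *(2) by (auto simp: q_def)
qed

lemma hess_propagates:
  assumes line: "\<And>t. t \<in> closed_segment 0 r \<Longrightarrow> p + t *\<^sub>R T \<in> U"
    and init: "hess p T T = 0" "hess p \<nu> \<nu> \<noteq> 0"
  shows "hess (p + r *\<^sub>R T) T T = 0 \<and> hess (p + r *\<^sub>R T) \<nu> \<nu> \<noteq> 0"
proof (cases "0 \<le> r")
  case True
  then show ?thesis
    using hess_propagates_forward[OF line _ init] by (auto simp: closed_segment_eq_real_ivl)
next
  case False
  have p: "p \<in> U" using line[of 0] by simp
  have neg: "hess q (- v) (- v) = hess q v v" if "q \<in> U" for q v
    using hess_scale_left[OF that, of "-1" v] hess_scale_right[OF that, of _ "-1" v] by simp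
  have "p + (- r) *\<^sub>R (- T) = p + r *\<^sub>R T" by simp
  moreover have "hess (p + (- r) *\<^sub>R (- T)) (- T) (- T) = 0 \<and> hess (p + (- r) *\<^sub>R (- T)) \<nu> \<nu> \<noteq> 0"
  proof (rule hess_propagates_forward)
    show "p + t *\<^sub>R - T \<in> U" if "0 \<le> t" "t \<le> - r" for t
      using line[of "- t"] that by (auto simp: closed_segment_eq_real_ivl)
  qed (use False init neg[OF p] in auto)
  ultimately show ?thesis using neg[OF line[of r]] by auto
qed

end

section \<open>Rulings of a Moebius band\<close>

definition open_strip :: "(real \<times> real) set" where
  "open_strip = UNIV \<times> {0<..<1}"

lemma open_open_strip: "open open_strip"
  unfolding open_strip_def by (intro open_Times) auto

lemma mem_open_strip [simp]: "(x, y) \<in> open_strip \<longleftrightarrow> 0 < y \<and> y < 1"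
  by (auto simp: open_strip_def)

lemma mem_strip [simp]: "(x, y) \<in> strip \<longleftrightarrow> 0 \<le> y \<and> y \<le> 1"
  by (auto simp: strip_def)

lemma open_strip_subset: "open_strip \<subseteq> strip"
  by auto

definition chord_point :: "real \<Rightarrow> real \<Rightarrow> real \<Rightarrow> real \<times> real" where
  "chord_point a a' y = ((1 - y) * a + y * a', y)"

locale moebius_lift =
  fixes l :: real and F :: "real \<times> real \<Rightarrow> real ^ 3"
  assumes l_pos: "0 < l"
    and smooth_F: "smooth_in open_strip F"
    and isometric_F: "\<And>p v w. p \<in> open_strip \<Longrightarrow> dderiv v F p \<bullet> dderiv w F p = v \<bullet> w"
    and periodic: "\<And>x y. \<lbrakk>0 \<le> y; y \<le> 1\<rbrakk> \<Longrightarrow> F (x + l, 1 - y) = F (x, y)"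
    and lipschitz: "\<And>p q. \<lbrakk>p \<in> strip; q \<in> strip\<rbrakk> \<Longrightarrow> dist (F p) (F q) \<le> dist p q"
begin

sublocale flat_immersion open_strip F
  by unfold_locales (auto intro: open_open_strip smooth_F isometric_F)

lemma continuous_on_F: "continuous_on strip F"
  unfolding continuous_on_iff using lipschitz by (meson order_le_less_trans)

lemma isometric_along_segment:
  assumes seg: "\<And>t. \<lbrakk>0 \<le> t; t \<le> 1\<rbrakk> \<Longrightarrow> p + t *\<^sub>R v \<in> open_strip \<and> hess (p + t *\<^sub>R v) v v = 0"
  shows "dist (F p) (F (p + v)) = norm v"
proof -
  have p: "p \<in> open_strip" using seg[of 0] by simp
  have 1: "dderiv v F (p + t *\<^sub>R v) = dderiv v F p" if "t \<in> {0..1}" for t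
  proof -
    have "((\<lambda>t. dderiv v F (p + t *\<^sub>R v)) has_vector_derivative 0) (at t within {0..1})" if "t \<in> {0..1}" for t
      using has_vector_derivative_line[OF open_U smooth_in_dderiv[OF smooth_F], of p t v v] seg[of t] that
      by (auto simp: hess_def intro: has_vector_derivative_at_within)
    from has_vector_derivative_zero_constant[OF convex_real_interval(5) this]
    obtain c where c: "\<And>t. t \<in> {0..1} \<Longrightarrow> dderiv v F (p + t *\<^sub>R v) = c" by metis
    show ?thesis using c[of 0] c[OF that] by simp
  qed
  have "((\<lambda>t. F (p + t *\<^sub>R v) - t *\<^sub>R dderiv v F p) has_vector_derivative 0) (at t within {0..1})"
    if t: "t \<in> {0..1}" for t
  proof -
    have "((\<lambda>t. F (p + t *\<^sub>R v) - t *\<^sub>R dderiv v F p) has_vector_derivative 0) (at t)"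
      using has_vector_derivative_line[OF open_U smooth_F, of p t v] seg[of t] t 1[OF t]
      by (auto intro!: derivative_eq_intros)
    then show ?thesis by (rule has_vector_derivative_at_within)
  qed
  from has_vector_derivative_zero_constant[OF convex_real_interval(5) this]
  obtain c where c: "\<And>t. t \<in> {0..1} \<Longrightarrow> F (p + t *\<^sub>R v) - t *\<^sub>R dderiv v F p = c" by metis
  have "F (p + v) - dderiv v F p = F p" using c[of 0] c[of 1] by simp
  then have "F (p + v) - F p = dderiv v F p" by (simp add: algebra_simps)
  then show ?thesis
    using isometric_F[OF p, of v v] by (metis dist_commute dist_norm norm_eq_sqrt_inner)
qed

text \<open>\<open>F\<close> would be isometric on a horizontal segment of length \<open>2 * l\<close>, whose ends have the same image.\<close>

lemma no_horizontal_kernel: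
  assumes "\<And>x. hess (x, y) (1, 0) (1, 0) = 0" "0 < y" "y < 1"
  shows False
proof -
  have "dist (F (0, y)) (F ((0, y) + (2 * l, 0))) = norm (2 * l, 0::real)"
  proof (rule isometric_along_segment)
    fix t :: real
    have "(2 * l, 0) = (2 * l) *\<^sub>R (1, 0::real)" by simp
    then have "hess (t * (2 * l), y) (2 * l, 0) (2 * l, 0) = 0"
      using assms by (metis mem_open_strip hess_scale_left hess_scale_right scaleR_zero_right)
    then show "(0, y) + t *\<^sub>R (2 * l, 0) \<in> open_strip \<and>
        hess ((0, y) + t *\<^sub>R (2 * l, 0)) (2 * l, 0) (2 * l, 0) = 0"
      using assms(2,3) by simp
  qed
  moreover have "F (2 * l, y) = F (0, y)"
    using periodic[of "1 - y" l] periodic[of y 0] assms(2,3) by simp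
  ultimately show False using l_pos by simp
qed

text \<open>Because \<open>F\<close> does not increase distances, this equation for the ends already makes \<open>F\<close> affine on
the chord.\<close>

definition straight :: "real \<Rightarrow> real \<Rightarrow> bool" where
  "straight a a' \<longleftrightarrow> dist (F (a, 0)) (F (a', 1)) = dist (a, 0::real) (a', 1)"

text \<open>The derivatives are only controlled in the open strip, so the equation for the ends is obtained
as a limit of the equation for interior points of the chord.\<close>

lemma straight_if_hess_zero:
  assumes hess0: "\<And>y. \<lbrakk>0 < y; y < 1\<rbrakk> \<Longrightarrow> hess (chord_point a a' y) (a' - a, 1) (a' - a, 1) = 0"
  shows "straight a a'"
proof -
  have inner: "dist (F (chord_point a a' y)) (F (chord_point a a' z)) =
      dist (chord_point a a' y) (chord_point a a' z)" if yz: "0 < y" "y \<le> z" "z < 1" for y z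
  proof -
    let ?v = "(z - y) *\<^sub>R (a' - a, 1::real)"
    have eq: "chord_point a a' y + t *\<^sub>R ?v = chord_point a a' (y + t * (z - y))" for t
      by (simp add: chord_point_def algebra_simps)
    have *: "0 < y + t * (z - y) \<and> y + t * (z - y) < 1" if "0 \<le> t" "t \<le> 1" for t
    proof -
      have "t * (z - y) \<le> 1 * (z - y)" using that yz by (intro mult_right_mono) auto
      then show ?thesis using that yz by (auto intro: add_pos_nonneg)
    qed
    have "dist (F (chord_point a a' y)) (F (chord_point a a' y + ?v)) = norm ?v"
    proof (rule isometric_along_segment, unfold eq)
      fix t :: real assume t: "0 \<le> t" "t \<le> 1"
      have in_strip: "chord_point a a' (y + t * (z - y)) \<in> open_strip"
        using *[OF t] by (simp add: chord_point_def)
      then show "chord_point a a' (y + t * (z - y)) \<in> open_strip \<and>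
          hess (chord_point a a' (y + t * (z - y))) ?v ?v = 0"
        using hess0[of "y + t * (z - y)"] *[OF t]
        by (simp only: hess_scale_left[OF in_strip] hess_scale_right[OF in_strip]) simp
    qed
    moreover have "chord_point a a' y + ?v = chord_point a a' z"
      using eq[of 1] by simp
    ultimately show ?thesis by (metis add_diff_cancel_left' dist_commute dist_norm)
  qed
  define u where "u n = inverse (real (Suc (Suc n)))" for n
  have u: "u \<longlonglongrightarrow> 0"
    unfolding u_def by (rule LIMSEQ_Suc[OF LIMSEQ_inverse_real_of_nat])
  have u01: "0 < u n" "u n \<le> 1 - u n" "1 - u n < 1" "u n \<le> 1" for n
    by (auto simp: u_def field_simps)
  have cp: "(\<lambda>n. chord_point a a' (w n)) \<longlonglongrightarrow> chord_point a a' w0" if "w \<longlonglongrightarrow> w0" for w w0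
    unfolding chord_point_def by (intro tendsto_intros that)
  have w: "(\<lambda>n. 1 - u n) \<longlonglongrightarrow> 1" using tendsto_diff[OF tendsto_const u, of 1] by simp
  have Fcp: "(\<lambda>n. F (chord_point a a' (w n))) \<longlonglongrightarrow> F (chord_point a a' w0)"
    if "w \<longlonglongrightarrow> w0" "\<And>n. 0 \<le> w n \<and> w n \<le> 1" "0 \<le> w0 \<and> w0 \<le> 1" for w w0
    using continuous_on_tendsto_compose[OF continuous_on_F cp[OF that(1)]] that(2,3)
    by (simp add: chord_point_def)
  have "(\<lambda>n. dist (F (chord_point a a' (u n))) (F (chord_point a a' (1 - u n))))
      \<longlonglongrightarrow> dist (F (chord_point a a' 0)) (F (chord_point a a' 1))"
    using u01 by (intro tendsto_dist Fcp u w) (auto intro: less_imp_le)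
  moreover have "(\<lambda>n. dist (chord_point a a' (u n)) (chord_point a a' (1 - u n)))
      \<longlonglongrightarrow> dist (chord_point a a' 0) (chord_point a a' 1)"
    by (intro tendsto_dist cp u w)
  moreover have "dist (F (chord_point a a' (u n))) (F (chord_point a a' (1 - u n))) =
      dist (chord_point a a' (u n)) (chord_point a a' (1 - u n))" for n
    using inner u01 by blast
  ultimately have "dist (F (chord_point a a' 0)) (F (chord_point a a' 1)) =
      dist (chord_point a a' 0) (chord_point a a' 1)"
    using LIMSEQ_unique by auto
  then show ?thesis by (simp add: straight_def chord_point_def)
qed

text \<open>A segment along which the surface bends. Where the second derivatives vanish altogether no
direction is distinguished, so such points are left out here and dealt with by the filling below.\<close>

definition ruling :: "real \<Rightarrow> real \<Rightarrow> bool" where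
  "ruling a a' \<longleftrightarrow> (\<forall>y. 0 < y \<and> y < 1 \<longrightarrow>
     hess (chord_point a a' y) (a' - a, 1) (a' - a, 1) = 0 \<and>
     (\<exists>\<nu>. hess (chord_point a a' y) \<nu> \<nu> \<noteq> 0))"

lemma ruling_imp_straight: "ruling a a' \<Longrightarrow> straight a a'"
  by (rule straight_if_hess_zero) (simp add: ruling_def)

lemma ruling_through:
  assumes p: "p \<in> open_strip" and \<nu>: "hess p \<nu> \<nu> \<noteq> 0"
  obtains a a' where "ruling a a'" "p = chord_point a a' (snd p)"
proof -
  obtain x y where xy: "p = (x, y)" by force
  have y: "0 < y" "y < 1" using p xy by auto
  obtain T where T: "T \<noteq> 0" "hess p T T = 0" using hess_kernel_exists[OF p] by blast
  obtain c d where cd: "T = (c, d)" by force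
  have "d \<noteq> 0"
  proof
    assume "d = 0"
    with T cd have c: "c \<noteq> 0" by (simp add: zero_prod_def)
    have "(1, 0) = (1 / c) *\<^sub>R T" using c cd \<open>d = 0\<close> by simp
    then have T1: "hess p (1,0) (1,0) = 0"
      using T(2) hess_scale_left[OF p, of "1/c"] hess_scale_right[OF p, of _ "1/c"] by simp
    have "hess (x', y) (1,0) (1,0) = 0" for x'
      using hess_propagates[of "x' - x" p "(1,0)" \<nu>] T1 \<nu> y by (simp add: xy)
    then show False using no_horizontal_kernel y by blast
  qed
  define V where "V = (c / d, 1::real)"
  have "V = (1 / d) *\<^sub>R T" using \<open>d \<noteq> 0\<close> by (simp add: V_def cd)
  then have V: "hess p V V = 0"
    using T(2) hess_scale_left[OF p, of "1/d"] hess_scale_right[OF p, of _ "1/d"] by simp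
  define a where "a = x - y * (c / d)"
  define a' where "a' = a + c / d"
  have cp: "chord_point a a' z = p + (z - y) *\<^sub>R V" for z
    by (simp add: chord_point_def a_def a'_def V_def xy algebra_simps add_divide_distrib[symmetric])
  have "ruling a a'"
    unfolding ruling_def
  proof (intro allI impI)
    fix z :: real assume z: "0 < z \<and> z < 1"
    have "hess (p + (z - y) *\<^sub>R V) V V = 0 \<and> hess (p + (z - y) *\<^sub>R V) \<nu> \<nu> \<noteq> 0"
    proof (rule hess_propagates[OF _ V \<nu>])
      fix t assume "t \<in> closed_segment 0 (z - y)"
      then show "p + t *\<^sub>R V \<in> open_strip"
        using y z by (auto simp: xy V_def closed_segment_eq_real_ivl split: if_splits)
    qed
    moreover have "(a' - a, 1) = V" by (simp add: V_def a'_def)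
    ultimately show "hess (chord_point a a' z) (a' - a, 1) (a' - a, 1) = 0 \<and>
        (\<exists>\<nu>. hess (chord_point a a' z) \<nu> \<nu> \<noteq> 0)"
      by (metis cp)
  qed
  moreover have "p = chord_point a a' (snd p)" by (simp add: cp xy)
  ultimately show ?thesis using that by blast
qed

lemma ruling_exists: "\<exists>a a'. ruling a a'"
proof -
  obtain x where "hess (x, 1/2) (1, 0) (1, 0) \<noteq> 0" using no_horizontal_kernel[of "1/2"] by auto
  moreover have "(x, 1/2) \<in> open_strip" by simp
  ultimately show ?thesis using ruling_through by metis
qed

text \<open>At a crossing the second derivatives would vanish in two independent directions, hence altogether.\<close>

lemma rulings_noncrossing:
  assumes "ruling a a'" "ruling b b'" "a < b"
  shows "a' \<le> b'"
proof (rule ccontr)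
  assume "\<not> a' \<le> b'"
  define y where "y = (b - a) / ((b - a) + (a' - b'))"
  have D: "(b - a) + (a' - b') > 0" using assms(3) \<open>\<not> a' \<le> b'\<close> by simp
  have y: "0 < y" "y < 1" using D assms(3) \<open>\<not> a' \<le> b'\<close> by (auto simp: y_def field_simps)
  have "y * ((b - a) + (a' - b')) = b - a" using D by (simp add: y_def)
  then have eq: "chord_point a a' y = chord_point b b' y"
    by (simp add: chord_point_def algebra_simps)
  define q where "q = chord_point a a' y"
  have q: "q \<in> open_strip" using y by (simp add: q_def chord_point_def)
  let ?V = "(a' - a, 1::real)" and ?W = "(b' - b, 1::real)"
  have "hess q ?V ?V = 0" "hess q ?W ?W = 0"
    using assms(1)[unfolded ruling_def, rule_format, of y] assms(2)[unfolded ruling_def, rule_format, of y] y eq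
    by (simp_all only: q_def)
  then have VW: "hess q ?V w = 0" "hess q ?W w = 0" for w
    using hess_kernel[OF q] by blast+
  have e1: "hess q (1,0) w = 0" for w
  proof -
    let ?c = "1 / ((a' - a) - (b' - b))"
    have nz: "(a' - a) - (b' - b) \<noteq> 0" using D by simp
    have "?c * (a' - a) - ?c * (b' - b) = 1"
      unfolding right_diff_distrib[symmetric] using nz by simp
    then have "(1,0) = ?c *\<^sub>R ?V + (- ?c) *\<^sub>R ?W" by simp
    then show ?thesis by (simp only: hess_add_left[OF q] hess_scale_left[OF q] VW) simp
  qed
  have e2: "hess q (0,1) w = 0" for w
  proof -
    have "(0,1) = ?V + (- (a' - a)) *\<^sub>R (1, 0)" by simp
    then show ?thesis by (simp only: hess_add_left[OF q] hess_scale_left[OF q] VW e1) simp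
  qed
  obtain \<nu> where "hess q \<nu> \<nu> \<noteq> 0" using assms(1) y by (auto simp: ruling_def q_def)
  then show False using hess_basis[OF q e1 e2] by blast
qed

lemma rulings_comparable:
  assumes "ruling a a'" "ruling b b'"
  shows "(a \<le> b \<and> a' \<le> b') \<or> (b \<le> a \<and> b' \<le> a')"
  using rulings_noncrossing[OF assms] rulings_noncrossing[OF assms(2,1)] by linarith

lemma dderiv_glide:
  fixes f g :: "real \<times> real \<Rightarrow> real ^ 3"
  assumes f: "smooth_in open_strip f" and g: "smooth_in open_strip g"
    and eq: "\<And>x y. \<lbrakk>0 < y; y < 1\<rbrakk> \<Longrightarrow> g (x + l, 1 - y) = f (x, y)" and y: "0 < y" "y < 1"
  shows "dderiv (v1, - v2) g (x + l, 1 - y) = dderiv (v1, v2) f (x, y)"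
proof -
  let ?G = "\<lambda>p::real \<times> real. (fst p + l, 1 - snd p)"
  have G: "(?G has_derivative (\<lambda>v. (fst v, - snd v))) (at (x, y))"
    by (auto intro!: derivative_eq_intros)
  have "(g has_derivative (\<lambda>v. dderiv v g (?G (x, y)))) (at (?G (x, y)))"
    by (rule has_derivative_dderiv[OF open_open_strip g]) (use y in simp)
  from has_derivative_compose[OF G this]
  have "((\<lambda>p. g (?G p)) has_derivative (\<lambda>v. dderiv (fst v, - snd v) g (x + l, 1 - y))) (at (x, y))"
    by simp
  then have "(f has_derivative (\<lambda>v. dderiv (fst v, - snd v) g (x + l, 1 - y))) (at (x, y))"
    by (rule has_derivative_transform_within_open[OF _ open_open_strip]) (use y eq in auto)
  from dderiv_unique[OF this, of "(v1, v2)"] show ?thesis by simp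
qed

lemma hess_glide:
  assumes y: "0 < y" "y < 1"
  shows "hess (x + l, 1 - y) (v1, - v2) (w1, - w2) = hess (x, y) (v1, v2) (w1, w2)"
  unfolding hess_def
  by (intro dderiv_glide smooth_in_dderiv smooth_F y) (auto intro!: periodic less_imp_le)

lemma ruling_glide_aux:
  assumes "ruling a a'" "a' + l = b \<and> a + l = b' \<or> a = b' + l \<and> a' = b + l"
  shows "ruling b b'"
  unfolding ruling_def
proof (intro allI impI)
  fix y :: real assume y: "0 < y \<and> y < 1"
  have R: "hess (chord_point a a' (1 - y)) (a' - a, 1) (a' - a, 1) = 0"
    and nz: "\<exists>\<nu>. hess (chord_point a a' (1 - y)) \<nu> \<nu> \<noteq> 0"
    using assms(1) y by (auto simp: ruling_def)
  obtain v1 v2 where \<nu>: "hess (chord_point a a' (1 - y)) (v1, v2) (v1, v2) \<noteq> 0" using nz by force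
  have transfer: "hess (chord_point b b' y) (v1, - v2) (w1, - w2) =
      hess (chord_point a a' (1 - y)) (v1, v2) (w1, w2)" for v1 v2 w1 w2
    using assms(2)
  proof
    assume "a' + l = b \<and> a + l = b'"
    then have "chord_point b b' y = (fst (chord_point a a' (1 - y)) + l, 1 - (1 - y))"
      by (auto simp: chord_point_def algebra_simps)
    then show ?thesis
      using hess_glide[of "1 - y" "fst (chord_point a a' (1 - y))" v1 v2 w1 w2] y by (simp add: chord_point_def)
  next
    assume "a = b' + l \<and> a' = b + l"
    then have "chord_point a a' (1 - y) = (fst (chord_point b b' y) + l, 1 - y)"
      by (auto simp: chord_point_def algebra_simps)
    then show ?thesis
      using hess_glide[of y "fst (chord_point b b' y)" v1 "- v2" w1 "- w2"] y by (simp add: chord_point_def)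
  qed
  have cs: "chord_point b b' y \<in> open_strip" using y by (simp add: chord_point_def)
  have neg: "(b' - b, 1) = (- 1) *\<^sub>R (a' - a, - 1::real)" using assms(2) by auto
  have "hess (chord_point b b' y) (a' - a, - 1) (a' - a, - 1) = 0" using transfer R by simp
  then have "hess (chord_point b b' y) (b' - b, 1) (b' - b, 1) = 0"
    unfolding neg by (simp only: hess_scale_left[OF cs] hess_scale_right[OF cs]) simp
  then show "hess (chord_point b b' y) (b' - b, 1) (b' - b, 1) = 0 \<and>
      (\<exists>\<nu>. hess (chord_point b b' y) \<nu> \<nu> \<noteq> 0)"
    using transfer[of v1 v2 v1 v2] \<nu> by metis
qed

lemma ruling_glide: "ruling (a' + l) (a + l) \<longleftrightarrow> ruling a a'"
  using ruling_glide_aux[of a a' "a' + l" "a + l"] ruling_glide_aux[of "a' + l" "a + l" a a'] by auto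

subsection \<open>Completing the rulings to a family of bends\<close>

definition rulings :: "(real \<times> real) set" where
  "rulings = {(a, a'). ruling a a'}"

text \<open>A chord is determined by the sum \<open>s\<close> of its end coordinates and its bottom end \<open>a\<close>. Rulings are
pairwise comparable, which says precisely that \<open>a\<close> and \<open>s - a\<close> are nondecreasing functions of \<open>s\<close>
on the rulings. The next two definitions are the least and the greatest extension with these
properties to all \<open>s\<close>, in the style of the McShane extension of a Lipschitz function.\<close>

definition lower_filling :: "real \<Rightarrow> real" where
  "lower_filling s = (SUP (a, a')\<in>rulings. a - max 0 (a + a' - s))"

definition upper_filling :: "real \<Rightarrow> real" where
  "upper_filling s = (INF (a, a')\<in>rulings. a + max 0 (s - (a + a')))"

text \<open>The glide reflection interchanges the bottom and the top end of a chord, and with them the two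
extensions. The average is taken because it commutes with the glide reflection.\<close>

definition bend_pos :: "real \<Rightarrow> real" where
  "bend_pos s = (lower_filling s + upper_filling s) / 2"

lemma rulings_nonempty: "rulings \<noteq> {}"
  using ruling_exists by (auto simp: rulings_def)

lemma filling_terms_le:
  assumes "ruling a a'" "ruling b b'"
  shows "a - max 0 (a + a' - s) \<le> b + max 0 (s - (b + b'))"
  using rulings_comparable[OF assms] by (auto simp: max_def)

lemma bdd_lower: "bdd_above ((\<lambda>(a, a'). a - max 0 (a + a' - s)) ` rulings)"
proof -
  obtain b b' where "ruling b b'" using ruling_exists by blast
  then show ?thesis
    using filling_terms_le by (intro bdd_aboveI[of _ "b + max 0 (s - (b + b'))"]) (auto simp: rulings_def)
qed

lemma bdd_upper: "bdd_below ((\<lambda>(a, a'). a + max 0 (s - (a + a'))) ` rulings)"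
proof -
  obtain b b' where "ruling b b'" using ruling_exists by blast
  then show ?thesis
    using filling_terms_le by (intro bdd_belowI[of _ "b - max 0 (b + b' - s)"]) (auto simp: rulings_def)
qed

lemma lower_ge: "ruling a a' \<Longrightarrow> a - max 0 (a + a' - s) \<le> lower_filling s"
  unfolding lower_filling_def
  using cSUP_upper[OF _ bdd_lower, of "(a, a')" s] by (simp add: rulings_def)

lemma lower_le: "(\<And>a a'. ruling a a' \<Longrightarrow> a - max 0 (a + a' - s) \<le> M) \<Longrightarrow> lower_filling s \<le> M"
  unfolding lower_filling_def by (rule cSUP_least[OF rulings_nonempty]) (auto simp: rulings_def)

lemma upper_le: "ruling a a' \<Longrightarrow> upper_filling s \<le> a + max 0 (s - (a + a'))"
  unfolding upper_filling_def
  using cINF_lower[OF bdd_upper, of "(a, a')" s] by (simp add: rulings_def)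

lemma upper_ge: "(\<And>a a'. ruling a a' \<Longrightarrow> M \<le> a + max 0 (s - (a + a'))) \<Longrightarrow> M \<le> upper_filling s"
  unfolding upper_filling_def by (rule cINF_greatest[OF rulings_nonempty]) (auto simp: rulings_def)

lemma bend_pos_ruling:
  assumes "ruling a a'"
  shows "bend_pos (a + a') = a"
proof -
  have "lower_filling (a + a') \<le> a"
    by (rule lower_le) (use filling_terms_le[OF _ assms, of _ _ "a + a'"] in simp)
  moreover have "a \<le> upper_filling (a + a')"
    by (rule upper_ge) (use filling_terms_le[OF assms, of _ _ "a + a'"] in simp)
  ultimately show ?thesis
    using lower_ge[OF assms, of "a + a'"] upper_le[OF assms, of "a + a'"] by (simp add: bend_pos_def)
qed

lemma lower_filling_step: "s \<le> t \<Longrightarrow> lower_filling s \<le> lower_filling t \<and> lower_filling t \<le> lower_filling s + (t - s)"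
proof (intro conjI lower_le)
  fix a a' assume st: "s \<le> t" and r: "ruling a a'"
  show "a - max 0 (a + a' - s) \<le> lower_filling t" using lower_ge[OF r, of t] st by (auto simp: max_def split: if_splits)
  show "a - max 0 (a + a' - t) \<le> lower_filling s + (t - s)"
    using lower_ge[OF r, of s] st by (auto simp: max_def split: if_splits)
qed

lemma upper_filling_step: "s \<le> t \<Longrightarrow> upper_filling s \<le> upper_filling t \<and> upper_filling t \<le> upper_filling s + (t - s)"
proof -
  assume st: "s \<le> t"
  have "upper_filling s \<le> upper_filling t"
    by (rule upper_ge) (use upper_le[of _ _ s] st in \<open>fastforce simp: max_def split: if_splits\<close>)
  moreover have "upper_filling t - (t - s) \<le> upper_filling s"
    by (rule upper_ge) (use upper_le[of _ _ t] st in \<open>fastforce simp: max_def split: if_splits\<close>)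
  ultimately show ?thesis by simp
qed

lemma bend_pos_mono: "s \<le> t \<Longrightarrow> bend_pos s \<le> bend_pos t"
  and bend_pos_mono': "s \<le> t \<Longrightarrow> s - bend_pos s \<le> t - bend_pos t"
  unfolding bend_pos_def using lower_filling_step[of s t] upper_filling_step[of s t]
  by (auto simp: field_simps)

lemma bend_pos_glide: "bend_pos (s + 2 * l) = s - bend_pos s + l"
proof -
  have shift: "ruling (a' - l) (a - l)" if "ruling a a'" for a a'
    using ruling_glide[of "a - l" "a' - l"] that by simp
  have "lower_filling (s + 2 * l) \<le> s + l - upper_filling s"
  proof (rule lower_le)
    fix a a' assume "ruling a a'"
    from upper_le[OF shift[OF this], of s]
    show "a - max 0 (a + a' - (s + 2 * l)) \<le> s + l - upper_filling s" by (auto simp: max_def split: if_splits)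
  qed
  moreover have "s + l - lower_filling (s + 2 * l) \<le> upper_filling s"
  proof (rule upper_ge)
    fix a a' assume "ruling a a'"
    then have "ruling (a' + l) (a + l)" by (simp add: ruling_glide)
    from lower_ge[OF this, of "s + 2 * l"]
    show "s + l - lower_filling (s + 2 * l) \<le> a + max 0 (s - (a + a'))" by (auto simp: max_def split: if_splits)
  qed
  moreover have "lower_filling s \<le> s + l - upper_filling (s + 2 * l)"
  proof (rule lower_le)
    fix a a' assume "ruling a a'"
    then have "ruling (a' + l) (a + l)" by (simp add: ruling_glide)
    from upper_le[OF this, of "s + 2 * l"]
    show "a - max 0 (a + a' - s) \<le> s + l - upper_filling (s + 2 * l)" by (auto simp: max_def split: if_splits)
  qed
  moreover have "s + l - lower_filling s \<le> upper_filling (s + 2 * l)"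
  proof (rule upper_ge)
    fix a a' assume "ruling a a'"
    from lower_ge[OF shift[OF this], of s]
    show "s + l - lower_filling s \<le> a + max 0 (s + 2 * l - (a + a'))" by (auto simp: max_def split: if_splits)
  qed
  ultimately have "lower_filling (s + 2 * l) = s + l - upper_filling s"
    "upper_filling (s + 2 * l) = s + l - lower_filling s" by simp_all
  then show ?thesis by (simp add: bend_pos_def field_simps)
qed

text \<open>A bend that is not a ruling meets no ruling: it is comparable with each of them, and two comparable
chords that share an interior point are equal. Hence the second derivatives vanish along it.\<close>

lemma bend_straight: "straight (bend_pos s) (s - bend_pos s)"
proof (cases "\<exists>a a'. ruling a a' \<and> a + a' = s")
  case True
  then show ?thesis using bend_pos_ruling ruling_imp_straight by fastforce
next
  case False
  let ?a = "bend_pos s" and ?a' = "s - bend_pos s"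
  show ?thesis
  proof (rule straight_if_hess_zero, rule ccontr)
    fix y :: real assume y: "0 < y" "y < 1"
    assume "hess (chord_point ?a ?a' y) (?a' - ?a, 1) (?a' - ?a, 1) \<noteq> 0"
    moreover have "chord_point ?a ?a' y \<in> open_strip" using y by (simp add: chord_point_def)
    ultimately obtain b b' where b: "ruling b b'" "chord_point ?a ?a' y = chord_point b b' y"
      using ruling_through by (metis chord_point_def snd_conv)
    \<comment> \<open>Both ends of the bend lie on the same side of those of the ruling, yet the two chords meet.\<close>
    have pos: "bend_pos (b + b') = b" by (rule bend_pos_ruling[OF b(1)])
    have eq: "(1 - y) * (?a - b) + y * (?a' - b') = 0"
      using b(2) by (simp add: chord_point_def algebra_simps)
    consider "b + b' \<le> s" | "s \<le> b + b'" by linarith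
    then have "?a = b \<and> ?a' = b'"
    proof cases
      case 1
      then have "0 \<le> ?a - b" "0 \<le> ?a' - b'"
        using bend_pos_mono[OF 1] bend_pos_mono'[OF 1] pos by auto
      then have "(1 - y) * (?a - b) = 0 \<and> y * (?a' - b') = 0"
        using eq y by (intro add_nonneg_eq_0_iff[THEN iffD1]) auto
      then show ?thesis using y by simp
    next
      case 2
      then have "0 \<le> b - ?a" "0 \<le> b' - ?a'"
        using bend_pos_mono[OF 2] bend_pos_mono'[OF 2] pos by auto
      moreover have "(1 - y) * (b - ?a) + y * (b' - ?a') = 0" using eq by (simp add: algebra_simps)
      ultimately have "(1 - y) * (b - ?a) = 0 \<and> y * (b' - ?a') = 0"
        using y by (intro add_nonneg_eq_0_iff[THEN iffD1]) auto
      then show ?thesis using y by simp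
    qed
    then show False using False b(1) by (metis add_diff_cancel_left' diff_add_cancel add.commute)
  qed
qed

end

section \<open>Perpendicular coplanar bends\<close>

text \<open>The values of \<open>w\<close> differ by multiples of \<open>2 * pi * \<i>\<close>, so continuity makes \<open>w\<close> constant.\<close>

lemma constant_exp_imp_constant:
  fixes w :: "real \<Rightarrow> complex"
  assumes "continuous_on {0..b} w" "\<And>t. t \<in> {0..b} \<Longrightarrow> exp (w t) = K" "0 \<le> b"
  shows "w b = w 0"
proof -
  have "w constant_on {0..b}"
  proof (rule continuous_discrete_range_constant[OF _ assms(1)])
    fix x assume x: "x \<in> {0..b}"
    have "2 * pi \<le> norm (w y - w x)" if "y \<in> {0..b}" "w y \<noteq> w x" for y
      using exp_complex_eqI[of "w y" "w x"] assms(2)[OF x] assms(2)[OF that(1)] that(2)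
        abs_Im_le_cmod[of "w y - w x"] by fastforce
    then show "\<exists>e>0. \<forall>y. y \<in> {0..b} \<and> w y \<noteq> w x \<longrightarrow> e \<le> norm (w y - w x)"
      using pi_gt_zero by (intro exI[of _ "2 * pi"]) auto
  qed simp
  then show ?thesis using assms(3) by (auto simp: constant_on_def)
qed

text \<open>Without a zero, \<open>f\<close> has a continuous logarithm \<open>g\<close> on the triangle. Along the diagonal \<open>f\<close> is
positive, so the imaginary part of \<open>g\<close> is constant there. The two legs carry opposite values of \<open>f\<close>,
so \<open>g (t, b) - g (0, t)\<close> is a constant \<open>c\<close> with \<open>exp c = -1\<close>. Taking \<open>t = 0\<close> and \<open>t = b\<close> shows that
the imaginary part of \<open>g\<close> changes by that of \<open>2 * c\<close> from one end of the diagonal to the other, which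
is a contradiction.\<close>

lemma triangle_zero:
  fixes f :: "real \<times> real \<Rightarrow> complex"
  assumes b: "0 \<le> b"
    and cont: "continuous_on {(s, t). 0 \<le> s \<and> s \<le> t \<and> t \<le> b} f"
    and diag: "\<And>s. \<lbrakk>0 \<le> s; s \<le> b\<rbrakk> \<Longrightarrow> f (s, s) \<in> \<real> \<and> 0 < Re (f (s, s))"
    and antisym: "\<And>t. \<lbrakk>0 \<le> t; t \<le> b\<rbrakk> \<Longrightarrow> f (t, b) = - f (0, t)"
  shows "\<exists>s t. 0 \<le> s \<and> s \<le> t \<and> t \<le> b \<and> f (s, t) = 0"
proof (rule ccontr)
  let ?T = "{(s, t). 0 \<le> s \<and> s \<le> t \<and> t \<le> b}"
  assume "\<not> (\<exists>s t. 0 \<le> s \<and> s \<le> t \<and> t \<le> b \<and> f (s, t) = 0)"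
  then have nz: "f z \<noteq> 0" if "z \<in> ?T" for z using that by auto
  have "?T = {z. 0 \<le> fst z} \<inter> {z. fst z - snd z \<le> 0} \<inter> {z. snd z \<le> b}" by auto
  moreover have "convex {z::real\<times>real. 0 \<le> fst z}"
    using convex_halfspace_ge[of 0 "(1, 0) :: real \<times> real"] by (simp add: inner_prod_def)
  moreover have "convex {z::real\<times>real. fst z - snd z \<le> 0}"
    using convex_halfspace_le[of "(1, -1) :: real \<times> real" 0] by (simp add: inner_prod_def)
  moreover have "convex {z::real\<times>real. snd z \<le> b}"
    using convex_halfspace_le[of "(0, 1) :: real \<times> real" b] by (simp add: inner_prod_def)
  ultimately have "convex ?T" by (simp add: convex_Int)
  then obtain g where g: "continuous_on ?T g" "\<And>z. z \<in> ?T \<Longrightarrow> f z = exp (g z)"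
    by (rule continuous_logarithm_on_contractible[OF cont convex_imp_contractible]) (use nz in blast)+
  have cg: "continuous_on {0..b} (\<lambda>t. g (u t, v t))"
    if "continuous_on {0..b} u" "continuous_on {0..b} v" "\<And>t. t \<in> {0..b} \<Longrightarrow> (u t, v t) \<in> ?T" for u v
    by (rule continuous_on_compose2[OF g(1)]) (use that in \<open>auto intro!: continuous_intros\<close>)
  have diag_exp: "exp (\<i> * Im (g (s, s))) = 1" if "s \<in> {0..b}" for s
  proof -
    have s: "(s, s) \<in> ?T" using that by simp
    have "f (s, s) = exp (g (s, s))" using g(2)[OF s] .
    moreover have "f (s, s) = of_real (Re (f (s, s)))" "0 < Re (f (s, s))"
      using diag[of s] that by (simp_all add: complex_is_Real_iff complex_eq_iff)
    ultimately have "sin (Im (g (s, s))) = 0" "0 < cos (Im (g (s, s)))"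
      by (simp_all add: complex_eq_iff Re_exp Im_exp zero_less_mult_iff)
    then have "cos (Im (g (s, s))) = 1"
      using sin_zero_abs_cos_one[of "Im (g (s, s))"] by simp
    then show ?thesis using \<open>sin _ = 0\<close> by (simp add: complex_eq_iff Re_exp Im_exp)
  qed
  have "\<i> * Im (g (b, b)) = \<i> * Im (g (0, 0))"
    by (rule constant_exp_imp_constant[of b "\<lambda>s. \<i> * Im (g (s, s))", OF _ diag_exp b])
      (use cg[of "\<lambda>s. s" "\<lambda>s. s"] in \<open>auto intro!: continuous_intros\<close>)
  then have diag_eq: "Im (g (b, b)) = Im (g (0, 0))" by simp
  have legs: "exp (g (t, b) - g (0, t)) = -1" if "t \<in> {0..b}" for t
  proof -
    have "exp (g (t, b)) = - exp (g (0, t))"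
      using g(2)[of "(t, b)"] g(2)[of "(0, t)"] antisym[of t] that by simp
    then show ?thesis by (simp add: exp_diff)
  qed
  have "g (b, b) - g (0, b) = g (0, b) - g (0, 0)"
    by (rule constant_exp_imp_constant[of b "\<lambda>t. g (t, b) - g (0, t)", OF _ legs b])
      (auto intro!: continuous_intros cg)
  then have "Im (g (0, b) - g (0, 0)) = 0" using diag_eq by (simp add: complex_eq_iff)
  moreover have "exp (g (0, b) - g (0, 0)) = -1" using legs[of 0] b by simp
  ultimately have "exp (Re (g (0, b) - g (0, 0))) = -1"
    using Re_exp[of "g (0, b) - g (0, 0)"] by simp
  then show False using exp_gt_zero[of "Re (g (0, b) - g (0, 0))"] by simp
qed

lemma zero_if_orthogonal_to_frame:
  fixes u v w :: "real ^ 3"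
  assumes "w \<bullet> u = 0" "w \<bullet> v = 0" "w \<bullet> cross3 u v = 0" "cross3 u v \<noteq> 0"
  shows "w = 0"
proof -
  have "cross3 w (cross3 u v) = 0" using assms(1,2) by (simp add: Lagrange)
  moreover have "cross3 n (cross3 w n) = (n \<bullet> n) *\<^sub>R w - (n \<bullet> w) *\<^sub>R n" for n
    by (rule Lagrange)
  ultimately show ?thesis
    using assms(3,4) by (metis cross_zero_right diff_zero inner_commute inner_eq_zero_iff scaleR_eq_0_iff scaleR_zero_left)
qed

lemma coplanar_lines_meet:
  fixes u v w :: "real ^ 3"
  assumes "u \<bullet> v = 0" "u \<noteq> 0" "v \<noteq> 0" "w \<bullet> cross3 u v = 0"
  shows "\<exists>r q. w = r *\<^sub>R u - q *\<^sub>R v"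
proof -
  define R where "R = w - (w \<bullet> u / (u \<bullet> u)) *\<^sub>R u - (w \<bullet> v / (v \<bullet> v)) *\<^sub>R v"
  have "(norm (cross3 u v))\<^sup>2 \<noteq> 0"
    using norm_cross_dot[of u v] assms(1-3) by (simp add: power_mult_distrib)
  then have n: "cross3 u v \<noteq> 0" by auto
  have "R = 0"
    by (rule zero_if_orthogonal_to_frame[OF _ _ _ n])
      (use assms in \<open>simp_all add: R_def inner_diff_left dot_cross_self inner_commute[of v u]\<close>)
  then have "w = (w \<bullet> u / (u \<bullet> u)) *\<^sub>R u - (- (w \<bullet> v / (v \<bullet> v))) *\<^sub>R v"
    by (simp add: R_def algebra_simps)
  then show ?thesis by blast
qed

text \<open>What the rest of the argument needs to know about a band. The curve \<open>\<gamma>\<close> is the single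
boundary curve, closing up after \<open>2 * l\<close>. The bend with parameter \<open>s\<close> joins \<open>\<gamma> (X s)\<close> to
\<open>\<gamma> (X (s + 2 * l))\<close>: a half turn of the band exchanges the two ends of a bend, so the second end is
the first end of the same bend after the glide reflection. Its horizontal offset in the strip is
\<open>X (s + 2 * l) - X s - l\<close>.\<close>

locale bend_family =
  fixes l :: real and \<gamma> :: "real \<Rightarrow> real ^ 3" and X :: "real \<Rightarrow> real"
  assumes l_pos: "0 < l"
    and boundary_lipschitz: "dist (\<gamma> x) (\<gamma> y) \<le> \<bar>x - y\<bar>"
    and boundary_periodic: "\<gamma> (x + 2 * l) = \<gamma> x"
    and X_mono: "s \<le> t \<Longrightarrow> X s \<le> X t"
    and X_mono': "s \<le> t \<Longrightarrow> s - X s \<le> t - X t"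
    and X_glide: "X (s + 2 * l) = s - X s + l"
    and bend_length: "(dist (\<gamma> (X s)) (\<gamma> (X (s + 2 * l))))\<^sup>2 = 1 + (X (s + 2 * l) - X s - l)\<^sup>2"
begin

definition direction :: "real \<Rightarrow> real ^ 3" where
  "direction s = \<gamma> (X (s + 2 * l)) - \<gamma> (X s)"

lemma X_two_turns: "X (s + 2 * l + 2 * l) = X s + 2 * l"
  using X_glide[of "s + 2 * l"] X_glide[of s] by simp

lemma direction_glide: "direction (s + 2 * l) = - direction s"
  unfolding direction_def X_two_turns boundary_periodic by simp

lemma norm_direction_ge: "1 \<le> norm (direction s)"
proof -
  have "1 \<le> (norm (direction s))\<^sup>2"
    using bend_length[of s] by (simp add: direction_def dist_norm norm_minus_commute)
  then show ?thesis using power2_le_imp_le[of 1 "norm (direction s)"] by simp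
qed

lemma direction_nonzero: "direction s \<noteq> 0"
  using norm_direction_ge[of s] by auto

lemma continuous_on_X: "continuous_on S X"
proof -
  have "dist (X s) (X t) \<le> dist s t" for s t
    using X_mono[of s t] X_mono[of t s] X_mono'[of s t] X_mono'[of t s]
    by (cases "s \<le> t") (auto simp: dist_real_def)
  then show ?thesis unfolding continuous_on_iff by (meson order_le_less_trans)
qed

lemma continuous_on_boundary: "continuous_on S \<gamma>"
  unfolding continuous_on_iff using boundary_lipschitz by (metis dist_real_def order_le_less_trans)

lemma continuous_on_bend_end: "continuous_on S f \<Longrightarrow> continuous_on S (\<lambda>x. \<gamma> (X (f x)))"
  by (rule continuous_on_compose2[OF continuous_on_boundary continuous_on_compose2[OF continuous_on_X]]) auto

lemma continuous_on_direction: "continuous_on S f \<Longrightarrow> continuous_on S (\<lambda>x. direction (f x))"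
  unfolding direction_def by (intro continuous_intros continuous_on_bend_end)

text \<open>The pairs \<open>(s, t)\<close> and \<open>(t, s + 2 * l)\<close> denote the same two bends, but one direction has been
reversed; this negates the inner product of the directions as well as the volume \<open>g\<close>, and gives the
antisymmetry that \<open>triangle_zero\<close> asks for.\<close>

lemma perpendicular_coplanar_bends:
  obtains s t where "s \<le> t" "t \<le> s + 2 * l" "direction s \<bullet> direction t = 0"
    "(\<gamma> (X t) - \<gamma> (X s)) \<bullet> cross3 (direction s) (direction t) = 0"
proof -
  define g where "g s t = (\<gamma> (X t) - \<gamma> (X s)) \<bullet> cross3 (direction s) (direction t)" for s t
  define f where "f = (\<lambda>(s, t). Complex (direction s \<bullet> direction t) (g s t))"
  have "\<exists>s t. 0 \<le> s \<and> s \<le> t \<and> t \<le> 2 * l \<and> f (s, t) = 0"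
  proof (rule triangle_zero)
    show "0 \<le> 2 * l" using l_pos by simp
    have cp: "continuous_on S (\<lambda>p. \<gamma> (X (fst p)))" "continuous_on S (\<lambda>p. \<gamma> (X (snd p)))"
      "continuous_on S (\<lambda>p. direction (fst p))" "continuous_on S (\<lambda>p. direction (snd p))"
      for S :: "(real \<times> real) set"
      by (intro continuous_on_bend_end continuous_on_direction continuous_intros)+
    show "continuous_on {(s, t). 0 \<le> s \<and> s \<le> t \<and> t \<le> 2 * l} f"
      unfolding f_def g_def case_prod_beta
      by (intro continuous_on_Complex continuous_on_inner continuous_on_diff continuous_on_cross cp)
    fix t assume t: "0 \<le> t" "t \<le> 2 * l"
    show "f (t, t) \<in> \<real> \<and> 0 < Re (f (t, t))"
      using direction_nonzero by (simp add: f_def g_def complex_is_Real_iff)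
    have "g t (2 * l) = - g 0 t"
    proof -
      have d: "direction (2 * l) = - direction 0" using direction_glide[of 0] by simp
      have e: "\<gamma> (X (2 * l)) = \<gamma> (X 0) + direction 0" by (simp add: direction_def)
      have "g t (2 * l) = (\<gamma> (X 0) + direction 0 - \<gamma> (X t)) \<bullet> cross3 (direction 0) (direction t)"
        unfolding g_def d e by (simp add: cross_skew[of "direction t"])
      also have "\<dots> = (\<gamma> (X 0) - \<gamma> (X t)) \<bullet> cross3 (direction 0) (direction t)"
        by (simp add: inner_add_left inner_diff_left dot_cross_self)
      finally show ?thesis by (simp add: g_def inner_diff_left)
    qed
    then show "f (t, 2 * l) = - f (0, t)"
      using direction_glide[of 0] by (simp add: f_def complex_eq_iff inner_commute)
  qed
  then obtain s t where "0 \<le> s" "s \<le> t" "t \<le> 2 * l" "direction s \<bullet> direction t = 0" "g s t = 0"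
    by (auto simp: f_def complex_eq_iff)
  then show ?thesis using that[of s t] by (auto simp: g_def)
qed

end

text \<open>This holds for an embedded band because bends that meet in the image meet in the band, where different
bends have no common interior point. Their directions are all that is compared below.\<close>

locale embedded_bend_family = bend_family +
  assumes bends_disjoint: "\<lbrakk>0 < y; y < 1; 0 < z; z < 1;
      \<gamma> (X s) + y *\<^sub>R direction s = \<gamma> (X t) + z *\<^sub>R direction t\<rbrakk>
    \<Longrightarrow> direction t = direction s \<or> direction t = - direction s"
begin

text \<open>Let the lines of two perpendicular coplanar bends meet at the point with parameter \<open>r\<close> on one and
\<open>q\<close> on the other. Perpendicular bends are different segments, so these parameters do not both lie
strictly between 0 and 1. If \<open>q\<close> does not, the second bend has an end at distance at least its own
length, hence at least 1, from the first line; otherwise the two bends exchange roles. Replacing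
parameters by their images under the glide reflection makes the far end the first end of its bend.\<close>

lemma T_pattern:
  obtains s t r where "s \<le> t" "t \<le> s + 2 * l"
    "(\<gamma> (X t) - (\<gamma> (X s) + r *\<^sub>R direction s)) \<bullet> direction s = 0"
    "1 \<le> norm (\<gamma> (X t) - (\<gamma> (X s) + r *\<^sub>R direction s))"
proof -
  note conclude = that
  have one_sided: thesis
    if st: "s \<le> t" "t \<le> s + 2 * l" "direction s \<bullet> direction t = 0"
      and meet: "\<gamma> (X s) + r *\<^sub>R direction s = \<gamma> (X t) + q *\<^sub>R direction t" and q: "q \<le> 0 \<or> 1 \<le> q" for s t r q
    using q
  proof
    assume "1 \<le> q"
    have eq: "\<gamma> (X t) - (\<gamma> (X s) + r *\<^sub>R direction s) = - (q *\<^sub>R direction t)"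
      using meet by simp
    have "1 * 1 \<le> q * norm (direction t)"
      using \<open>1 \<le> q\<close> norm_direction_ge by (intro mult_mono) auto
    then show thesis
      using \<open>1 \<le> q\<close> st by (intro conclude[of s t r]) (simp_all add: eq inner_commute)
  next
    assume "q \<le> 0"
    have ends: "\<gamma> (X (t + 2 * l)) = \<gamma> (X t) + direction t" "\<gamma> (X (s + 2 * l)) = \<gamma> (X s) + direction s"
      by (simp_all add: direction_def)
    have eq: "\<gamma> (X (t + 2 * l)) - (\<gamma> (X (s + 2 * l)) + (1 - r) *\<^sub>R direction (s + 2 * l)) = (1 - q) *\<^sub>R direction t"
      unfolding ends direction_glide using meet by (simp add: algebra_simps)
    have "1 * 1 \<le> (1 - q) * norm (direction t)"
      using \<open>q \<le> 0\<close> norm_direction_ge by (intro mult_mono) auto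
    then show thesis
      using \<open>q \<le> 0\<close> st by (intro conclude[of "s + 2 * l" "t + 2 * l" "1 - r"])
        (simp_all only: eq, simp_all add: direction_glide inner_commute)
  qed
  obtain s t where st: "s \<le> t" "t \<le> s + 2 * l" "direction s \<bullet> direction t = 0"
    "(\<gamma> (X t) - \<gamma> (X s)) \<bullet> cross3 (direction s) (direction t) = 0"
    by (rule perpendicular_coplanar_bends)
  obtain r q where "\<gamma> (X t) - \<gamma> (X s) = r *\<^sub>R direction s - q *\<^sub>R direction t"
    using coplanar_lines_meet[OF st(3) direction_nonzero direction_nonzero st(4)] by blast
  then have meet: "\<gamma> (X s) + r *\<^sub>R direction s = \<gamma> (X t) + q *\<^sub>R direction t"
    by (simp add: algebra_simps)
  show thesis
  proof (cases "q \<le> 0 \<or> 1 \<le> q")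
    case True
    then show thesis using one_sided[OF st(1-3) meet] by blast
  next
    case q: False
    have r: "r \<le> 0 \<or> 1 \<le> r"
    proof (rule ccontr)
      assume "\<not> (r \<le> 0 \<or> 1 \<le> r)"
      then have "direction t = direction s \<or> direction t = - direction s"
        using bends_disjoint[of r q s t] q meet by auto
      then show False using st(3) direction_nonzero[of s] by auto
    qed
    have opp: "\<gamma> (X (s + 2 * l)) = \<gamma> (X s) + direction s" by (simp add: direction_def)
    have meet': "\<gamma> (X t) + q *\<^sub>R direction t = \<gamma> (X (s + 2 * l)) + (1 - r) *\<^sub>R direction (s + 2 * l)"
      unfolding opp direction_glide using meet by (simp add: algebra_simps)
    show thesis
      by (rule one_sided[OF _ _ _ meet']) (use st r in \<open>auto simp: direction_glide inner_commute\<close>)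
  qed
qed

end

section \<open>Near-optimal bands\<close>

text \<open>Cutting along a bend of length \<open>w\<close> and offset \<open>\<tau>\<close> yields a trapezoid with parallel sides \<open>l - \<tau>\<close>
and \<open>l + \<tau>\<close>. The longer side is folded over a point at height \<open>h\<close> above the bend and at distance \<open>x\<close> from
its perpendicular bisector, with \<open>r1\<close> and \<open>r2\<close> the distances of this point from the ends of the bend.
Both hypotheses on lengths become linear in \<open>\<tau>\<close> once they are squared, and confine \<open>\<tau>\<close> to an interval of
length \<open>2 * \<epsilon>\<close> that contains the value \<open>sqrt 3 / 3\<close> of the optimal band. The bounds on \<open>x\<close> and \<open>h\<close> express
that the point lies in a thin region between the line at height 1 and an ellipse with foci at the ends of
the bend.\<close>

lemma trapezoid_estimates:
  fixes l \<tau> w x h r1 r2 \<epsilon> :: real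
  assumes \<epsilon>: "0 < \<epsilon>" "\<epsilon> < 1 / 384" and l: "l < sqrt 3 + \<epsilon>"
    and w: "0 \<le> w" "w\<^sup>2 = 1 + \<tau>\<^sup>2" "w \<le> l - \<tau>"
    and r: "0 \<le> r1" "0 \<le> r2" "r1 + r2 \<le> l + \<tau>"
      "r1\<^sup>2 = (w / 2 + x)\<^sup>2 + h\<^sup>2" "r2\<^sup>2 = (w / 2 - x)\<^sup>2 + h\<^sup>2"
    and h: "1 \<le> h"
  shows "\<bar>w / 2 - sqrt 3 / 3\<bar> \<le> 2 / 3 * \<epsilon>" "x\<^sup>2 \<le> 12 / 5 * \<epsilon>" "h \<le> 1 + \<epsilon>"
    "(l + \<tau>)\<^sup>2 - (r1 + r2)\<^sup>2 \<le> 7 * \<epsilon>" "(l - \<tau>)\<^sup>2 - w\<^sup>2 \<le> 7 * \<epsilon>"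
proof -
  define c where "c = sqrt 3"
  have c: "c\<^sup>2 = 3" "0 < c" by (auto simp: c_def)
  have c_up: "c \<le> 17321 / 10000" unfolding c_def by (rule real_le_lsqrt) (auto simp: power2_eq_square)
  have c_lo: "17 / 10 \<le> c" unfolding c_def by (rule real_le_rsqrt) (auto simp: power2_eq_square)
  \<comment> \<open>The larger value \<open>L\<close> in place of \<open>l\<close> only weakens the two length constraints.\<close>
  define L where "L = c + \<epsilon>"
  have lL: "l < L" using l by (simp add: L_def c_def)
  have L2: "L\<^sup>2 = 3 + 2 * c * \<epsilon> + \<epsilon>\<^sup>2" using c by (simp add: L_def power2_eq_square algebra_simps)
  have e2: "\<epsilon>\<^sup>2 \<le> \<epsilon> / 384"
    using mult_left_mono[of \<epsilon> "1 / 384" \<epsilon>] \<epsilon> by (simp add: power2_eq_square)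
  have L0: "0 < L" using c \<epsilon> by (simp add: L_def)
  define a where "a = r1 + r2"
  have r1: "w / 2 + x \<le> r1" by (rule power2_le_imp_le[OF _ r(1)]) (simp add: r(4))
  have r2: "w / 2 - x \<le> r2" by (rule power2_le_imp_le[OF _ r(2)]) (simp add: r(5))
  have "h\<^sup>2 \<le> r1\<^sup>2" using r(4) by simp
  then have r1h: "h \<le> r1" using r(1) by (rule power2_le_imp_le)
  have a_pos: "0 < a" using r1h h r(2) by (simp add: a_def)
  have aw: "w \<le> a" using r1 r2 by (simp add: a_def)
  have "(r1 - r2) * a = 2 * w * x"
    using r(4,5) by (simp add: a_def power2_eq_square algebra_simps)
  moreover have "a\<^sup>2 + (r1 - r2)\<^sup>2 = w\<^sup>2 + 4 * x\<^sup>2 + 4 * h\<^sup>2"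
    using r(4,5) by (simp add: a_def power2_eq_square algebra_simps)
  ultimately have "a\<^sup>2 * a\<^sup>2 + (2 * w * x)\<^sup>2 = (w\<^sup>2 + 4 * x\<^sup>2 + 4 * h\<^sup>2) * a\<^sup>2"
    by (metis distrib_right power_mult_distrib)
  \<comment> \<open>The equation of the ellipse of points whose distances from the ends of the bend sum up to \<open>a\<close>.\<close>
  then have ellipse: "(a\<^sup>2 - w\<^sup>2 - 4 * h\<^sup>2) * a\<^sup>2 = 4 * x\<^sup>2 * (a\<^sup>2 - w\<^sup>2)"
    by (simp add: power2_eq_square algebra_simps)
  have aw2: "w\<^sup>2 \<le> a\<^sup>2" using aw w(1) by (rule power_mono)
  then have "0 \<le> (a\<^sup>2 - w\<^sup>2 - 4 * h\<^sup>2) * a\<^sup>2" unfolding ellipse by simp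
  then have D_lo: "4 * h\<^sup>2 \<le> a\<^sup>2 - w\<^sup>2" using a_pos by (simp add: zero_le_mult_iff)
  have h2: "1 \<le> h\<^sup>2" using h by simp
  have "w\<^sup>2 \<le> (L - \<tau>)\<^sup>2" using w lL by (intro power_mono) auto
  then have top: "2 * L * \<tau> \<le> L\<^sup>2 - 1" using w(2) by (simp add: power2_eq_square algebra_simps)
  have "a\<^sup>2 \<le> (L + \<tau>)\<^sup>2" using r(3) lL a_pos by (intro power_mono) (auto simp: a_def)
  then have bottom: "5 \<le> L\<^sup>2 + 2 * L * \<tau>"
    using w(2) D_lo h2 by (simp add: power2_eq_square algebra_simps)
  have up: "2 * L * \<tau> \<le> 2 + 2 * c * \<epsilon> + \<epsilon>\<^sup>2" using top L2 by simp
  have lo: "2 - 2 * c * \<epsilon> - \<epsilon>\<^sup>2 \<le> 2 * L * \<tau>" using bottom L2 by simp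
  have tau_up: "\<tau> \<le> c / 3 + 2 / 3 * \<epsilon>"
  proof -
    have "2 * L * (c / 3 + 2 / 3 * \<epsilon>) = 2 * c\<^sup>2 / 3 + 2 * c * \<epsilon> + 4 / 3 * \<epsilon>\<^sup>2"
      by (simp add: L_def power2_eq_square algebra_simps)
    then have "(2 * L) * \<tau> \<le> (2 * L) * (c / 3 + 2 / 3 * \<epsilon>)"
      using up c zero_le_power2[of \<epsilon>] by linarith
    then show ?thesis using L0 by simp
  qed
  have tau_lo: "c / 3 - 4 / 3 * \<epsilon> \<le> \<tau>"
  proof -
    have "2 * L * (c / 3 - 4 / 3 * \<epsilon>) = 2 * c\<^sup>2 / 3 - 2 * c * \<epsilon> - 8 / 3 * \<epsilon>\<^sup>2"
      by (simp add: L_def power2_eq_square algebra_simps)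
    then have "(2 * L) * (c / 3 - 4 / 3 * \<epsilon>) \<le> (2 * L) * \<tau>"
      using lo c zero_le_power2[of \<epsilon>] by linarith
    then show ?thesis using L0 by simp
  qed
  \<comment> \<open>The constant 7 is just above \<open>4 * sqrt 3\<close>.\<close>
  have ce: "4 * c * \<epsilon> + 2 * \<epsilon>\<^sup>2 \<le> 7 * \<epsilon>"
  proof -
    have "c * \<epsilon> \<le> 17321 / 10000 * \<epsilon>" using c_up \<epsilon> by (intro mult_right_mono) auto
    moreover have "4 * c * \<epsilon> = 4 * (c * \<epsilon>)" by simp
    ultimately show ?thesis using e2 \<epsilon> by linarith
  qed
  have "(l + \<tau>)\<^sup>2 \<le> (L + \<tau>)\<^sup>2" using r lL a_pos by (intro power_mono) (auto simp: a_def)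
  also have "\<dots> = L\<^sup>2 + 2 * L * \<tau> + (w\<^sup>2 - 1)" using w(2) by (simp add: power2_eq_square algebra_simps)
  finally have D_up: "(l + \<tau>)\<^sup>2 - w\<^sup>2 \<le> 4 + 7 * \<epsilon>" using up L2 ce by simp
  show "(l + \<tau>)\<^sup>2 - (r1 + r2)\<^sup>2 \<le> 7 * \<epsilon>" using D_up D_lo h2 by (simp add: a_def)
  have "(l - \<tau>)\<^sup>2 \<le> (L - \<tau>)\<^sup>2" using w lL by (intro power_mono) auto
  also have "\<dots> = L\<^sup>2 - 2 * L * \<tau> + (w\<^sup>2 - 1)" using w(2) by (simp add: power2_eq_square algebra_simps)
  finally show "(l - \<tau>)\<^sup>2 - w\<^sup>2 \<le> 7 * \<epsilon>" using lo L2 ce by simp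
  have aup: "a\<^sup>2 \<le> (l + \<tau>)\<^sup>2" using r a_pos by (intro power_mono) (auto simp: a_def)
  then have D: "a\<^sup>2 - w\<^sup>2 \<le> 4 + 7 * \<epsilon>" using D_up by simp
  have "h\<^sup>2 \<le> 1 + 7 / 4 * \<epsilon>" using D D_lo by simp
  also have "\<dots> \<le> (1 + \<epsilon>)\<^sup>2" using \<epsilon> by (simp add: power2_eq_square algebra_simps)
  finally have "h\<^sup>2 \<le> (1 + \<epsilon>)\<^sup>2" .
  then show "h \<le> 1 + \<epsilon>" by (rule power2_le_imp_le) (use \<epsilon> in simp)
  have tau_abs: "\<bar>\<tau> - c / 3\<bar> \<le> 4 / 3 * \<epsilon>" using tau_up tau_lo \<epsilon> unfolding abs_le_iff by linarith
  have "\<tau> \<le> 29 / 50" using tau_up c_up \<epsilon> by simp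
  moreover have "0 \<le> \<tau>" using tau_lo c_lo \<epsilon> by simp
  ultimately have "\<tau>\<^sup>2 \<le> (29 / 50)\<^sup>2" by (intro power_mono) auto
  then have w_up: "w\<^sup>2 \<le> 67 / 50" using w(2) by (simp add: power2_eq_square)
  show "x\<^sup>2 \<le> 12 / 5 * \<epsilon>"
  proof -
    define D0 where "D0 = a\<^sup>2 - w\<^sup>2"
    have D0: "4 \<le> D0" using D_lo h2 by (simp add: D0_def)
    have "4 * x\<^sup>2 * D0 = (D0 - 4 * h\<^sup>2) * (D0 + w\<^sup>2)"
      using ellipse by (simp add: D0_def)
    also have "\<dots> \<le> (7 * \<epsilon>) * (D0 + w\<^sup>2)"
      using D h2 D0 by (intro mult_right_mono) (auto simp: D0_def)
    also have "\<dots> \<le> (7 * \<epsilon>) * (D0 + 67 / 200 * D0)"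
      using w_up D0 \<epsilon> by (intro mult_left_mono) auto
    also have "\<dots> \<le> (4 * (12 / 5 * \<epsilon>)) * D0"
    proof -
      have "0 \<le> \<epsilon> * D0" using \<epsilon> D0 by simp
      then show ?thesis by (simp add: algebra_simps)
    qed
    finally have "(4 * x\<^sup>2) * D0 \<le> (4 * (12 / 5 * \<epsilon>)) * D0" .
    then show ?thesis using D0 by simp
  qed
  have tw: "\<bar>\<tau>\<bar> \<le> w" by (rule power2_le_imp_le[OF _ w(1)]) (simp add: w(2))
  have "(w - 2 * (c / 3)) * (w + 2 * (c / 3)) = (\<tau> - c / 3) * (\<tau> + c / 3)"
    using w(2) c(1) by (simp add: power2_eq_square algebra_simps)
  then have "\<bar>w - 2 * (c / 3)\<bar> * \<bar>w + 2 * (c / 3)\<bar> = \<bar>\<tau> - c / 3\<bar> * \<bar>\<tau> + c / 3\<bar>"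
    unfolding abs_mult[symmetric] by simp
  moreover have "\<bar>w + 2 * (c / 3)\<bar> = w + 2 * (c / 3)" using w(1) c(2) by simp
  ultimately have "\<bar>w - 2 * (c / 3)\<bar> * (w + 2 * (c / 3)) = \<bar>\<tau> - c / 3\<bar> * \<bar>\<tau> + c / 3\<bar>" by simp
  also have "\<dots> \<le> (4 / 3 * \<epsilon>) * (w + 2 * (c / 3))"
  proof (rule mult_mono[OF tau_abs])
    show "\<bar>\<tau> + c / 3\<bar> \<le> w + 2 * (c / 3)" using tw c(2) by linarith
  qed (use \<epsilon> in auto)
  finally have "\<bar>w - 2 * (c / 3)\<bar> \<le> 4 / 3 * \<epsilon>"
    using w(1) c(2) by (simp add: add_nonneg_pos)
  then show "\<bar>w / 2 - sqrt 3 / 3\<bar> \<le> 2 / 3 * \<epsilon>" by (auto simp: c_def abs_if split: if_splits)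
qed

text \<open>Stewart's theorem.\<close>

lemma stewart:
  fixes a b z :: "'a::real_inner"
  shows "(norm (z - ((1 - \<mu>) *\<^sub>R a + \<mu> *\<^sub>R b)))\<^sup>2 =
    (1 - \<mu>) * (norm (z - a))\<^sup>2 + \<mu> * (norm (z - b))\<^sup>2 - \<mu> * (1 - \<mu>) * (norm (a - b))\<^sup>2"
proof -
  define u where "u = z - a"
  define v where "v = z - b"
  have "z - ((1 - \<mu>) *\<^sub>R a + \<mu> *\<^sub>R b) = (1 - \<mu>) *\<^sub>R u + \<mu> *\<^sub>R v" "a - b = v - u"
    by (simp_all add: u_def v_def algebra_simps)
  then show ?thesis
    unfolding u_def[symmetric] v_def[symmetric]
    by (simp add: power2_norm_eq_inner inner_add_left inner_add_right inner_diff_left inner_diff_right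
        inner_commute[of v u]) (simp add: algebra_simps power2_eq_square)
qed

text \<open>By Stewart's theorem the squared distance is at most \<open>\<mu> * (1 - \<mu>) * (d\<^sup>2 - (dist a b)\<^sup>2)\<close>. The point \<open>z\<close> is
meant to divide an arc of length \<open>d\<close> from \<open>a\<close> to \<open>b\<close> in the ratio given by \<open>\<mu>\<close>.\<close>

lemma arc_near_chord:
  fixes a b z :: "'a::real_inner"
  assumes \<mu>: "0 \<le> \<mu>" "\<mu> \<le> 1" and za: "dist z a \<le> \<mu> * d" and zb: "dist z b \<le> (1 - \<mu>) * d"
    and slack: "d\<^sup>2 - (dist a b)\<^sup>2 \<le> \<kappa>"
  shows "(dist z ((1 - \<mu>) *\<^sub>R a + \<mu> *\<^sub>R b))\<^sup>2 \<le> \<kappa> / 4"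
proof -
  have "(dist z ((1 - \<mu>) *\<^sub>R a + \<mu> *\<^sub>R b))\<^sup>2
      = (1 - \<mu>) * (dist z a)\<^sup>2 + \<mu> * (dist z b)\<^sup>2 - \<mu> * (1 - \<mu>) * (dist a b)\<^sup>2"
    by (simp add: dist_norm stewart)
  also have "\<dots> \<le> (1 - \<mu>) * (\<mu> * d)\<^sup>2 + \<mu> * ((1 - \<mu>) * d)\<^sup>2 - \<mu> * (1 - \<mu>) * (dist a b)\<^sup>2"
    using \<mu> za zb by (intro diff_right_mono add_mono mult_left_mono power_mono) auto
  also have "\<dots> = (\<mu> * (1 - \<mu>)) * (d\<^sup>2 - (dist a b)\<^sup>2)"
    by (simp add: power2_eq_square algebra_simps)
  finally have *: "(dist z ((1 - \<mu>) *\<^sub>R a + \<mu> *\<^sub>R b))\<^sup>2 \<le> (\<mu> * (1 - \<mu>)) * (d\<^sup>2 - (dist a b)\<^sup>2)" .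
  have q: "0 \<le> \<mu> * (1 - \<mu>)" "\<mu> * (1 - \<mu>) \<le> 1 / 4"
    using mult_nonneg_nonneg[of \<mu> "1 - \<mu>"] \<mu> zero_le_power2[of "\<mu> - 1 / 2"]
    by (simp_all add: power2_eq_square algebra_simps)
  have "dist a b \<le> dist z a + dist z b" by (metis dist_commute dist_triangle)
  also have "\<dots> \<le> d" using za zb by (simp add: algebra_simps)
  finally have "0 \<le> d\<^sup>2 - (dist a b)\<^sup>2" by (simp add: power_mono)
  then have "(\<mu> * (1 - \<mu>)) * (d\<^sup>2 - (dist a b)\<^sup>2) \<le> 1 / 4 * (d\<^sup>2 - (dist a b)\<^sup>2)"
    using q by (intro mult_right_mono)
  with * slack show ?thesis by simp
qed

lemma dist_convex_combination:
  fixes a b c d :: "'a::real_normed_vector"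
  assumes "0 \<le> y" "y \<le> 1" "dist a c \<le> \<rho>" "dist b d \<le> \<rho>"
  shows "dist ((1 - y) *\<^sub>R a + y *\<^sub>R b) ((1 - y) *\<^sub>R c + y *\<^sub>R d) \<le> \<rho>"
proof -
  have "dist ((1 - y) *\<^sub>R a + y *\<^sub>R b) ((1 - y) *\<^sub>R c + y *\<^sub>R d)
      = norm ((1 - y) *\<^sub>R (a - c) + y *\<^sub>R (b - d))"
    by (simp add: dist_norm algebra_simps)
  also have "\<dots> \<le> (1 - y) * dist a c + y * dist b d"
    using assms(1,2) by (intro norm_triangle_le) (simp add: dist_norm)
  also have "\<dots> \<le> (1 - y) * \<rho> + y * \<rho>"
    using assms by (intro add_mono mult_left_mono) auto
  finally show ?thesis by (simp add: algebra_simps)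
qed

text \<open>In the coordinates \<open>(p, q)\<close> of a triangle with base vertex at the origin, a segment moves with one end
at \<open>(\<alpha>, 0)\<close> and the other at \<open>(0, 1 - \<beta>)\<close>. It starts at the side \<open>{0} \<times> {0..1}\<close> and ends as the segment
from \<open>(1, 0)\<close> to \<open>(0, 1 - b)\<close>, so the points below the final segment are swept over. The function
\<open>\<phi>\<close> below tells on which side of the line of the segment \<open>(p, q)\<close> lies.\<close>

lemma chord_sweep:
  fixes \<alpha> \<beta> :: "real \<Rightarrow> real"
  assumes cont: "continuous_on {c..d} \<alpha>" "continuous_on {c..d} \<beta>"
    and range: "\<And>s. s \<in> {c..d} \<Longrightarrow> 0 \<le> \<alpha> s \<and> \<beta> s \<le> b"
    and e: "e0 \<in> {c..d}" "e1 \<in> {c..d}" "\<alpha> e0 = 0" "\<beta> e0 = 0" "\<alpha> e1 = 1" "\<beta> e1 = b"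
    and pq: "0 < p" "0 < q" "p < 1" "q \<le> (1 - b) * (1 - p)"
  obtains s y where "s \<in> {c..d}" "0 \<le> y" "y \<le> 1" "p = (1 - y) * \<alpha> s" "q = y * (1 - \<beta> s)"
proof -
  define \<phi> where "\<phi> s = p * (1 - \<beta> s) + q * \<alpha> s - \<alpha> s * (1 - \<beta> s)" for s
  have "connected (\<phi> ` {c..d})"
    unfolding \<phi>_def by (intro connected_continuous_image continuous_intros cont) simp
  moreover have "\<phi> e0 \<in> \<phi> ` {c..d}" "\<phi> e1 \<in> \<phi> ` {c..d}" using e by auto
  moreover have "\<phi> e1 \<le> 0" "0 \<le> \<phi> e0" using e pq by (auto simp: \<phi>_def algebra_simps)
  ultimately have "0 \<in> \<phi> ` {c..d}" by (blast intro: connectedD_interval)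
  then obtain s where s: "s \<in> {c..d}" "\<phi> s = 0" by auto
  have "0 < (1 - b) * (1 - p)" using pq by linarith
  then have "b < 1" using pq(3) by (simp add: zero_less_mult_iff)
  then have B: "0 < 1 - \<beta> s" using range[OF s(1)] by simp
  have "\<alpha> s \<noteq> 0"
  proof
    assume "\<alpha> s = 0"
    then show False using s(2) B pq(1) by (simp add: \<phi>_def)
  qed
  then have A: "0 < \<alpha> s" using range[OF s(1)] by simp
  have eq: "p / \<alpha> s + q / (1 - \<beta> s) = 1"
    using s(2) A B by (simp add: \<phi>_def field_simps)
  define y where "y = q / (1 - \<beta> s)"
  have "0 \<le> p / \<alpha> s" "0 \<le> y" "1 - y = p / \<alpha> s"
    using A B pq eq by (simp_all add: y_def)
  moreover from this have "y \<le> 1" by linarith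
  moreover have "p = (1 - y) * \<alpha> s" "q = y * (1 - \<beta> s)"
    using A B \<open>1 - y = p / \<alpha> s\<close> by (simp_all add: y_def)
  ultimately show thesis using s(1) that by blast
qed

context bend_family
begin

definition surface :: "(real ^ 3) set" where
  "surface = range \<gamma> \<union> (\<Union>s. closed_segment (\<gamma> (X s)) (\<gamma> (X (s + 2 * l))))"

lemma boundary_arc_near_segment:
  assumes ab: "a < b" "a \<le> z" "z \<le> b" and \<kappa>: "(b - a)\<^sup>2 - (dist (\<gamma> a) (\<gamma> b))\<^sup>2 \<le> \<kappa>"
    and near: "dist (\<gamma> a) A \<le> \<eta>" "dist (\<gamma> b) B \<le> \<eta>"
  shows "dist (\<gamma> z) ((1 - (z - a) / (b - a)) *\<^sub>R A + ((z - a) / (b - a)) *\<^sub>R B) \<le> sqrt (\<kappa> / 4) + \<eta>"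
proof -
  let ?\<mu> = "(z - a) / (b - a)"
  have \<mu>: "0 \<le> ?\<mu>" "?\<mu> \<le> 1" using ab by auto
  have "dist (\<gamma> z) (\<gamma> a) \<le> ?\<mu> * (b - a)" "dist (\<gamma> z) (\<gamma> b) \<le> (1 - ?\<mu>) * (b - a)"
  proof -
    have "?\<mu> * (b - a) = z - a" using ab by simp
    moreover from this have "(1 - ?\<mu>) * (b - a) = b - z" by (simp add: algebra_simps)
    ultimately show "dist (\<gamma> z) (\<gamma> a) \<le> ?\<mu> * (b - a)" "dist (\<gamma> z) (\<gamma> b) \<le> (1 - ?\<mu>) * (b - a)"
      using boundary_lipschitz[of z a] boundary_lipschitz[of z b] ab by simp_all
  qed
  from arc_near_chord[OF \<mu> this \<kappa>]
  have "dist (\<gamma> z) ((1 - ?\<mu>) *\<^sub>R \<gamma> a + ?\<mu> *\<^sub>R \<gamma> b) \<le> sqrt (\<kappa> / 4)"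
    by (rule real_le_rsqrt)
  moreover have "dist ((1 - ?\<mu>) *\<^sub>R \<gamma> a + ?\<mu> *\<^sub>R \<gamma> b) ((1 - ?\<mu>) *\<^sub>R A + ?\<mu> *\<^sub>R B) \<le> \<eta>"
    by (rule dist_convex_combination[OF \<mu> near])
  ultimately show ?thesis
    using dist_triangle by (smt (verit))
qed

lemma periodic_reduce: "\<exists>z'. a \<le> z' \<and> z' \<le> a + 2 * l \<and> \<gamma> z' = \<gamma> z"
proof -
  have shift: "\<gamma> (x + real n * (2 * l)) = \<gamma> x" for x n
  proof (induction n)
    case (Suc n)
    then show ?case using boundary_periodic[of "x + real n * (2 * l)"] by (simp add: algebra_simps)
  qed simp
  have shift_int: "\<gamma> (x - of_int k * (2 * l)) = \<gamma> x" for x k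
  proof (cases "0 \<le> k")
    case True
    then show ?thesis using shift[of "x - of_int k * (2 * l)" "nat k"] by simp
  next
    case False
    then show ?thesis using shift[of x "nat (- k)"] by (simp add: algebra_simps)
  qed
  define k where "k = \<lfloor>(z - a) / (2 * l)\<rfloor>"
  have "of_int k \<le> (z - a) / (2 * l)" "(z - a) / (2 * l) \<le> of_int k + 1"
    unfolding k_def by linarith+
  then have "of_int k * (2 * l) \<le> z - a" "z - a \<le> (of_int k + 1) * (2 * l)"
    using l_pos by (auto simp: field_simps)
  then show ?thesis
    using shift_int[of z k] by (intro exI[of _ "z - of_int k * (2 * l)"]) (auto simp: algebra_simps)
qed

text \<open>The boundary curve is near the polygon \<open>AVBA\<close>, traversed proportionally to arc length, and a bend is
near the segment that joins the corresponding points of the polygon. So the image is near the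
triangle. Conversely those segments sweep over the whole triangle: from \<open>AB\<close> to the segment that
starts at \<open>V\<close> they cover the part of the triangle on the side of \<open>A\<close>, and from there to \<open>BA\<close> the part on
the side of \<open>B\<close>.\<close>

lemma surface_near_triangle:
  assumes order: "s \<le> t" "t \<le> s + 2 * l"
    and strict: "X s < X t" "X t < X (s + 2 * l)" "X (s + 2 * l) < X s + 2 * l"
    and A: "dist (\<gamma> (X s)) A \<le> \<eta>" and B: "dist (\<gamma> (X (s + 2 * l))) B \<le> \<eta>" and V: "dist (\<gamma> (X t)) V \<le> \<eta>"
    and slack: "(X t - X s)\<^sup>2 - (dist (\<gamma> (X s)) (\<gamma> (X t)))\<^sup>2 \<le> \<kappa>"
      "(X (s + 2 * l) - X t)\<^sup>2 - (dist (\<gamma> (X t)) (\<gamma> (X (s + 2 * l))))\<^sup>2 \<le> \<kappa>"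
      "(X s + 2 * l - X (s + 2 * l))\<^sup>2 - (dist (\<gamma> (X s)) (\<gamma> (X (s + 2 * l))))\<^sup>2 \<le> \<kappa>"
    and \<rho>: "sqrt (\<kappa> / 4) + \<eta> \<le> \<rho>"
  shows "\<And>z. z \<in> surface \<Longrightarrow> \<exists>n\<in>convex hull {A, B, V}. dist z n \<le> \<rho>"
    and "\<And>n. n \<in> convex hull {A, B, V} \<Longrightarrow> \<exists>z\<in>surface. dist z n \<le> \<rho>"
proof -
  define a where "a = X s"
  define m where "m = X t"
  define b where "b = X (s + 2 * l)"
  define d where "d = X s + 2 * l"
  have lt: "a < m" "m < b" "b < d" using strict by (auto simp: a_def m_def b_def d_def)
  have \<gamma>d: "\<gamma> d = \<gamma> a" by (simp add: d_def a_def boundary_periodic)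
  have slack': "(d - b)\<^sup>2 - (dist (\<gamma> b) (\<gamma> d))\<^sup>2 \<le> \<kappa>"
    using slack(3) \<gamma>d by (simp add: a_def b_def d_def dist_commute)
  define T where "T = convex hull {A, B, V}"
  have convT: "convex T" by (simp add: T_def)
  have inT: "A \<in> T" "B \<in> T" "V \<in> T" by (auto simp: T_def hull_inc)
  have comb: "(1 - \<mu>) *\<^sub>R c + \<mu> *\<^sub>R c' \<in> T" if "0 \<le> \<mu>" "\<mu> \<le> 1" "c \<in> T" "c' \<in> T" for \<mu> c c'
    using convexD_alt[OF convT that(3,4,1,2)] .
  have arc: "dist (\<gamma> z) ((1 - (z - x) / (y - x)) *\<^sub>R C + ((z - x) / (y - x)) *\<^sub>R C') \<le> \<rho>"
    if "x < y" "x \<le> z" "z \<le> y" "(y - x)\<^sup>2 - (dist (\<gamma> x) (\<gamma> y))\<^sup>2 \<le> \<kappa>"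
      "dist (\<gamma> x) C \<le> \<eta>" "dist (\<gamma> y) C' \<le> \<eta>" for x y z C C'
    using boundary_arc_near_segment[OF that] \<rho> by linarith
  have arcT: "\<exists>n\<in>T. dist (\<gamma> z) n \<le> \<rho>"
    if "x < y" "x \<le> z" "z \<le> y" "(y - x)\<^sup>2 - (dist (\<gamma> x) (\<gamma> y))\<^sup>2 \<le> \<kappa>"
      "dist (\<gamma> x) C \<le> \<eta>" "dist (\<gamma> y) C' \<le> \<eta>" "C \<in> T" "C' \<in> T" for x y z C C'
    using arc[OF that(1-6)] comb[OF _ _ that(7,8), of "(z - x) / (y - x)"] that(1-3) by auto
  note arc_am = arc[OF lt(1) _ _ slack(1)[folded a_def m_def] A[folded a_def] V[folded m_def]]
  note arc_mb = arc[OF lt(2) _ _ slack(2)[folded b_def m_def] V[folded m_def] B[folded b_def]]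
  note arc_bd = arc[OF lt(3) _ _ slack' B[folded b_def] A[folded a_def \<gamma>d]]
  have bdry: "\<exists>n\<in>T. dist (\<gamma> z) n \<le> \<rho>" for z
  proof -
    obtain z' where z': "a \<le> z'" "z' \<le> d" "\<gamma> z' = \<gamma> z"
      using periodic_reduce[of a z] by (auto simp: d_def a_def)
    consider "z' \<le> m" | "m \<le> z'" "z' \<le> b" | "b \<le> z'" by linarith
    then show ?thesis
    proof cases
      case 1
      then show ?thesis unfolding z'(3)[symmetric]
        using arcT[OF lt(1) _ _ slack(1)[folded a_def m_def] A[folded a_def] V[folded m_def] inT(1) inT(3)] z' by blast
    next
      case 2
      then show ?thesis unfolding z'(3)[symmetric]
        using arcT[OF lt(2) 2 slack(2)[folded b_def m_def] V[folded m_def] B[folded b_def] inT(3) inT(2)] by blast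
    next
      case 3
      then show ?thesis unfolding z'(3)[symmetric]
        using arcT[OF lt(3) _ _ slack' B[folded b_def] A[folded a_def \<gamma>d] inT(2) inT(1)] z' by blast
    qed
  qed
  show "\<exists>n\<in>convex hull {A, B, V}. dist z n \<le> \<rho>" if z: "z \<in> surface" for z
  proof -
    consider x where "z = \<gamma> x" | u where "z \<in> closed_segment (\<gamma> (X u)) (\<gamma> (X (u + 2 * l)))"
      using z by (auto simp: surface_def)
    then show ?thesis
    proof cases
      case 1
      then show ?thesis using bdry T_def by blast
    next
      case 2
      then obtain y where y: "0 \<le> y" "y \<le> 1" "z = (1 - y) *\<^sub>R \<gamma> (X u) + y *\<^sub>R \<gamma> (X (u + 2 * l))"
        by (auto simp: in_segment)
      obtain n n' where n: "n \<in> T" "dist (\<gamma> (X u)) n \<le> \<rho>" "n' \<in> T" "dist (\<gamma> (X (u + 2 * l))) n' \<le> \<rho>"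
        using bdry by meson
      have "(1 - y) *\<^sub>R n + y *\<^sub>R n' \<in> T" using comb y n by blast
      moreover have "dist z ((1 - y) *\<^sub>R n + y *\<^sub>R n') \<le> \<rho>"
        unfolding y(3) by (rule dist_convex_combination) (use y n in auto)
      ultimately show ?thesis by (auto simp: T_def)
    qed
  qed
  have bend_in: "(1 - y) *\<^sub>R \<gamma> (X u) + y *\<^sub>R \<gamma> (X (u + 2 * l)) \<in> surface" if "0 \<le> y" "y \<le> 1" for y u
    using that by (auto simp: surface_def in_segment)
  have \<gamma>_in: "\<gamma> z \<in> surface" for z by (simp add: surface_def)
  show "\<exists>z\<in>surface. dist z n \<le> \<rho>" if n: "n \<in> convex hull {A, B, V}" for n
  proof -
    obtain p q where pq: "0 \<le> p" "0 \<le> q" "p + q \<le> 1" "n = A + p *\<^sub>R (V - A) + q *\<^sub>R (B - A)"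
    proof -
      from n obtain u v w where "0 \<le> u" "0 \<le> v" "0 \<le> w" "u + v + w = 1"
        "n = u *\<^sub>R A + v *\<^sub>R B + w *\<^sub>R V" unfolding convex_hull_3 by blast
      moreover from this have "u = 1 - v - w" by simp
      ultimately show thesis by (intro that[of w v]) (auto simp: algebra_simps)
    qed
    define q' where "q' = 1 - p - q"
    have n': "n = B + p *\<^sub>R (V - B) + q' *\<^sub>R (A - B)"
      by (simp add: pq(4) q'_def algebra_simps)
    have q': "0 \<le> q'" using pq by (simp add: q'_def)
    consider "p = 0" | "q = 0" | "q' = 0" | "0 < p" "0 < q" "0 < q'"
      using pq q' by (metis order_le_less)
    then show ?thesis
    proof cases
      case 1
      define z where "z = b + (1 - q) * (d - b)"
      have e: "(z - b) / (d - b) = 1 - q" using lt by (simp add: z_def)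
      have "(1 - q) * (d - b) \<le> d - b" by (rule mult_left_le_one_le) (use lt pq in auto)
      moreover have "0 \<le> (1 - q) * (d - b)" using lt pq by simp
      ultimately have "b \<le> z" "z \<le> d" unfolding z_def by linarith+
      then have "dist (\<gamma> z) n \<le> \<rho>"
        using arc_bd[of z] 1 unfolding e by (simp add: pq(4) algebra_simps)
      then show ?thesis using \<gamma>_in by blast
    next
      case 2
      define z where "z = a + p * (m - a)"
      have e: "(z - a) / (m - a) = p" using lt by (simp add: z_def)
      have "(p) * (m - a) \<le> m - a" by (rule mult_left_le_one_le) (use lt pq in auto)
      moreover have "0 \<le> (p) * (m - a)" using lt pq by simp
      ultimately have "a \<le> z" "z \<le> m" unfolding z_def by linarith+
      then have "dist (\<gamma> z) n \<le> \<rho>"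
        using arc_am[of z] 2 unfolding e by (simp add: pq(4) algebra_simps)
      then show ?thesis using \<gamma>_in by blast
    next
      case 3
      define z where "z = m + (1 - p) * (b - m)"
      have e: "(z - m) / (b - m) = 1 - p" using lt by (simp add: z_def)
      have "(1 - p) * (b - m) \<le> b - m" by (rule mult_left_le_one_le) (use lt pq in auto)
      moreover have "0 \<le> (1 - p) * (b - m)" using lt pq by simp
      ultimately have "m \<le> z" "z \<le> b" unfolding z_def by linarith+
      then have "dist (\<gamma> z) n \<le> \<rho>"
        using arc_mb[of z] 3 unfolding e by (simp add: n' algebra_simps)
      then show ?thesis using \<gamma>_in by blast
    next
      case 4
      define \<beta> where "\<beta> u = (X (u + 2 * l) - b) / (d - b)" for u
      have cont_\<beta>: "continuous_on S \<beta>" for S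
        unfolding \<beta>_def using lt
        by (intro continuous_intros continuous_on_compose2[OF continuous_on_X]) auto
      have \<beta>s: "\<beta> s = 0" by (simp add: \<beta>_def b_def)
      have \<beta>e: "\<beta> (s + 2 * l) = 1" using lt unfolding \<beta>_def X_two_turns by (simp add: d_def)
      have \<beta>_mono: "\<beta> u \<le> \<beta> v" if "u \<le> v" for u v
        using X_mono[of "u + 2 * l" "v + 2 * l"] that lt by (simp add: \<beta>_def divide_right_mono)
      have p1: "p < 1" using 4 pq by (simp add: q'_def)
      have top: "dist (\<gamma> (X (u + 2 * l))) ((1 - \<beta> u) *\<^sub>R B + \<beta> u *\<^sub>R A) \<le> \<rho>" if "s \<le> u" "u \<le> s + 2 * l" for u
      proof -
        have "b \<le> X (u + 2 * l)" "X (u + 2 * l) \<le> d"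
          using X_mono[of "s + 2 * l" "u + 2 * l"] X_mono[of "u + 2 * l" "s + 2 * l + 2 * l", unfolded X_two_turns] that
          by (simp_all add: b_def d_def)
        from arc_bd[OF this] show ?thesis by (simp add: \<beta>_def)
      qed
      show ?thesis
      proof (cases "q \<le> (1 - \<beta> t) * (1 - p)")
        case True
        define \<alpha> where "\<alpha> u = (X u - a) / (m - a)" for u
        have cont_\<alpha>: "continuous_on {s..t} \<alpha>"
          unfolding \<alpha>_def using lt by (intro continuous_intros continuous_on_X) auto
        have rng: "0 \<le> \<alpha> u \<and> \<beta> u \<le> \<beta> t" if "u \<in> {s..t}" for u
          using X_mono[of s u] \<beta>_mono[of u t] that lt by (simp add: \<alpha>_def a_def)
        have ends: "s \<in> {s..t}" "t \<in> {s..t}" "\<alpha> s = 0" "\<alpha> t = 1"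
          using order lt by (auto simp: \<alpha>_def a_def m_def)
        obtain u y where u: "u \<in> {s..t}" "0 \<le> y" "y \<le> 1" "p = (1 - y) * \<alpha> u" "q = y * (1 - \<beta> u)"
          using chord_sweep[OF cont_\<alpha> cont_\<beta> rng ends(1,2,3) \<beta>s ends(4) refl 4(1,2) p1 True] by blast
        have "dist (\<gamma> (X u)) ((1 - \<alpha> u) *\<^sub>R A + \<alpha> u *\<^sub>R V) \<le> \<rho>"
          using arc_am[of "X u"] X_mono[of s u] X_mono[of u t] u(1) by (simp add: \<alpha>_def a_def m_def)
        from dist_convex_combination[OF u(2,3) this top[of u]]
        have "dist ((1 - y) *\<^sub>R \<gamma> (X u) + y *\<^sub>R \<gamma> (X (u + 2 * l)))
            ((1 - y) *\<^sub>R ((1 - \<alpha> u) *\<^sub>R A + \<alpha> u *\<^sub>R V) + y *\<^sub>R ((1 - \<beta> u) *\<^sub>R B + \<beta> u *\<^sub>R A)) \<le> \<rho>"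
          using u(1) order by auto
        moreover have "(1 - y) *\<^sub>R ((1 - \<alpha> u) *\<^sub>R A + \<alpha> u *\<^sub>R V) + y *\<^sub>R ((1 - \<beta> u) *\<^sub>R B + \<beta> u *\<^sub>R A) = n"
          unfolding pq(4) u(4,5) by (simp add: algebra_simps)
        ultimately show ?thesis using bend_in[OF u(2,3)] by metis
      next
        case False
        define \<alpha> where "\<alpha> u = (b - X u) / (b - m)" for u
        have cont_\<alpha>: "continuous_on {t..s + 2 * l} \<alpha>"
          unfolding \<alpha>_def using lt by (intro continuous_intros continuous_on_X) auto
        have cont_\<beta>': "continuous_on {t..s + 2 * l} (\<lambda>u. 1 - \<beta> u)"
          by (intro continuous_intros cont_\<beta>)
        have rng: "0 \<le> \<alpha> u \<and> 1 - \<beta> u \<le> 1 - \<beta> t" if "u \<in> {t..s + 2 * l}" for u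
          using X_mono[of u "s + 2 * l"] \<beta>_mono[of t u] that lt by (simp add: \<alpha>_def b_def)
        have ends: "s + 2 * l \<in> {t..s + 2 * l}" "t \<in> {t..s + 2 * l}" "\<alpha> (s + 2 * l) = 0" "1 - \<beta> (s + 2 * l) = 0" "\<alpha> t = 1"
          using order lt by (auto simp: \<alpha>_def b_def m_def \<beta>e)
        have "q' \<le> (1 - (1 - \<beta> t)) * (1 - p)"
          using False by (simp add: q'_def algebra_simps)
        then obtain u y where u: "u \<in> {t..s + 2 * l}" "0 \<le> y" "y \<le> 1" "p = (1 - y) * \<alpha> u" "q' = y * (1 - (1 - \<beta> u))"
          using chord_sweep[OF cont_\<alpha> cont_\<beta>' rng ends refl 4(1,3) p1] by blast
        have "dist (\<gamma> (X u)) ((1 - (X u - m) / (b - m)) *\<^sub>R V + ((X u - m) / (b - m)) *\<^sub>R B) \<le> \<rho>"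
          using arc_mb[of "X u"] X_mono[of t u] X_mono[of u "s + 2 * l"] u(1) by (simp add: b_def m_def)
        moreover have "(X u - m) / (b - m) = 1 - \<alpha> u"
          using lt by (simp add: \<alpha>_def field_simps)
        ultimately have "dist (\<gamma> (X u)) (\<alpha> u *\<^sub>R V + (1 - \<alpha> u) *\<^sub>R B) \<le> \<rho>" by simp
        from dist_convex_combination[OF u(2,3) this top[of u]]
        have "dist ((1 - y) *\<^sub>R \<gamma> (X u) + y *\<^sub>R \<gamma> (X (u + 2 * l)))
            ((1 - y) *\<^sub>R (\<alpha> u *\<^sub>R V + (1 - \<alpha> u) *\<^sub>R B) + y *\<^sub>R ((1 - \<beta> u) *\<^sub>R B + \<beta> u *\<^sub>R A)) \<le> \<rho>"
          using u(1) order by auto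
        moreover have "(1 - y) *\<^sub>R (\<alpha> u *\<^sub>R V + (1 - \<alpha> u) *\<^sub>R B) + y *\<^sub>R ((1 - \<beta> u) *\<^sub>R B + \<beta> u *\<^sub>R A) = n"
          unfolding n' u(4,5) by (simp add: algebra_simps)
        ultimately show ?thesis using bend_in[OF u(2,3)] by metis
      qed
    qed
  qed
qed

end

context embedded_bend_family
begin

text \<open>The equilateral triangle is placed in the plane of the T-pattern, with its base centred on the base
bend and on the same line.\<close>

theorem near_equilateral_triangle:
  assumes \<epsilon>: "0 < \<epsilon>" "\<epsilon> < 1 / 384" and l: "l < sqrt 3 + \<epsilon>"
  obtains T where "equilateral_triangle (2 * sqrt 3) T"
    "\<And>z. z \<in> surface \<Longrightarrow> \<exists>n\<in>T. dist z n \<le> 3 * sqrt \<epsilon>"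
    "\<And>n. n \<in> T \<Longrightarrow> \<exists>z\<in>surface. dist z n \<le> 3 * sqrt \<epsilon>"
proof -
  obtain s t r where st: "s \<le> t" "t \<le> s + 2 * l"
    and perp: "(\<gamma> (X t) - (\<gamma> (X s) + r *\<^sub>R direction s)) \<bullet> direction s = 0"
    and far: "1 \<le> norm (\<gamma> (X t) - (\<gamma> (X s) + r *\<^sub>R direction s))"
    by (rule T_pattern)
  define P where "P = \<gamma> (X s)"
  define Q where "Q = \<gamma> (X (s + 2 * l))"
  define V where "V = \<gamma> (X t)"
  define w where "w = norm (direction s)"
  define a where "a = direction s /\<^sub>R w"
  define W where "W = V - (P + r *\<^sub>R direction s)"
  define h where "h = norm W"
  \<comment> \<open>An orthonormal frame of the plane of the T-pattern: \<open>a\<close> along the base bend, \<open>n\<close> towards \<open>V\<close>.\<close>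
  define n where "n = W /\<^sub>R h"
  define \<tau> where "\<tau> = X (s + 2 * l) - X s - l"
  define x where "x = (r - 1 / 2) * w"
  have w1: "1 \<le> w" using norm_direction_ge by (simp add: w_def)
  have h1: "1 \<le> h" using far by (simp add: h_def W_def V_def P_def)
  have dir: "direction s = w *\<^sub>R a" "Q = P + w *\<^sub>R a"
    using w1 by (simp_all add: a_def) (simp add: direction_def P_def Q_def)
  have "a \<bullet> a = 1" using w1 by (simp add: a_def w_def[symmetric] dot_square_norm power2_eq_square)
  moreover have "n \<bullet> n = 1" using h1 by (simp add: n_def h_def[symmetric] dot_square_norm power2_eq_square)
  moreover have "n \<bullet> a = 0" using perp by (simp add: n_def a_def W_def V_def P_def)
  ultimately have frame: "a \<bullet> a = 1" "n \<bullet> n = 1" "n \<bullet> a = 0" "a \<bullet> n = 0" by (simp_all add: inner_commute)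
  have coords: "(norm (y *\<^sub>R a + z *\<^sub>R n))\<^sup>2 = y\<^sup>2 + z\<^sup>2" for y z
    by (simp only: power2_norm_eq_inner) (simp add: inner_simps frame power2_eq_square)
  define M where "M = P + (w / 2) *\<^sub>R a"
  have P: "P = M - (w / 2) *\<^sub>R a" by (simp add: M_def)
  have Q: "Q = M + (w / 2) *\<^sub>R a" by (simp add: M_def dir scaleR_add_left[symmetric] add.assoc)
  have "W = h *\<^sub>R n" using h1 by (simp add: n_def)
  then have "V = P + r *\<^sub>R (w *\<^sub>R a) + h *\<^sub>R n" by (simp add: W_def dir(1) algebra_simps)
  then have V: "V = M + (x *\<^sub>R a + h *\<^sub>R n)" by (simp add: M_def x_def algebra_simps)
  have PV: "(dist P V)\<^sup>2 = (w / 2 + x)\<^sup>2 + h\<^sup>2"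
  proof -
    have "V - P = (w / 2 + x) *\<^sub>R a + h *\<^sub>R n" by (simp add: V P algebra_simps)
    then show ?thesis by (metis coords dist_commute dist_norm)
  qed
  have VQ: "(dist V Q)\<^sup>2 = (w / 2 - x)\<^sup>2 + h\<^sup>2"
  proof -
    have "V - Q = (x - w / 2) *\<^sub>R a + h *\<^sub>R n" by (simp add: V Q algebra_simps)
    then show ?thesis by (metis coords dist_norm power2_commute)
  qed
  have PQ: "dist P Q = w" by (simp add: w_def direction_def P_def Q_def dist_norm norm_minus_commute)
  have w2: "w\<^sup>2 = 1 + \<tau>\<^sup>2"
    using bend_length[of s] by (simp add: PQ[symmetric] P_def Q_def \<tau>_def)
  have mono: "X s \<le> X t" "X t \<le> X (s + 2 * l)" "X (s + 2 * l) \<le> X s + 2 * l"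
    using X_mono[of s t] X_mono[of t "s + 2 * l"] X_mono[of "s + 2 * l" "s + 2 * l + 2 * l", unfolded X_two_turns] st l_pos
    by simp_all
  have d1: "dist P V \<le> X t - X s" using boundary_lipschitz[of "X s" "X t"] mono by (simp add: P_def V_def)
  have d2: "dist V Q \<le> X (s + 2 * l) - X t"
    using boundary_lipschitz[of "X t" "X (s + 2 * l)"] mono by (simp add: Q_def V_def)
  have d3: "w \<le> l - \<tau>"
    using boundary_lipschitz[of "X s + 2 * l" "X (s + 2 * l)"] mono boundary_periodic[of "X s"]
    by (simp add: PQ[symmetric] P_def Q_def \<tau>_def)
  have d12: "dist P V + dist V Q \<le> l + \<tau>" using d1 d2 by (simp add: \<tau>_def)
  note est = trapezoid_estimates[OF \<epsilon> l _ w2 d3 zero_le_dist zero_le_dist d12 PV VQ h1]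
  have w0: "0 \<le> w" using w1 by simp
  have "h\<^sup>2 \<le> (dist P V)\<^sup>2" "h\<^sup>2 \<le> (dist V Q)\<^sup>2" using PV VQ by simp_all
  then have "h \<le> dist P V" "h \<le> dist V Q" by (auto intro: power2_le_imp_le)
  then have strict: "X s < X t" "X t < X (s + 2 * l)" "X (s + 2 * l) < X s + 2 * l"
    using d1 d2 d3 h1 w1 by (auto simp: \<tau>_def)
  define k where "k = sqrt 3 / 3"
  have k2: "k\<^sup>2 = 1 / 3" by (simp add: k_def power_divide)
  \<comment> \<open>Half the side of the equilateral triangle of height 1 is \<open>k\<close>.\<close>
  define P0 where "P0 = M - k *\<^sub>R a"
  define Q0 where "Q0 = M + k *\<^sub>R a"
  define V0 where "V0 = M + n"
  have k0: "0 \<le> k" by (simp add: k_def)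
  have k4: "sqrt (4 / 3) = 2 * k"
    by (rule real_sqrt_unique) (simp_all add: power_mult_distrib k2 k0)
  have "P0 - Q0 = (- (2 * k)) *\<^sub>R a + 0 *\<^sub>R n"
    by (simp add: P0_def Q0_def scaleR_scaleR[symmetric] scaleR_2 del: scaleR_scaleR)
  then have "(dist P0 Q0)\<^sup>2 = 4 / 3"
    using coords[of "- (2 * k)" 0] k2 by (simp add: dist_norm power_mult_distrib)
  moreover have "Q0 - V0 = k *\<^sub>R a + (-1) *\<^sub>R n" by (simp add: V0_def Q0_def)
  then have "(dist Q0 V0)\<^sup>2 = 4 / 3" using coords[of k "-1"] k2 by (simp add: dist_norm)
  moreover have "V0 - P0 = k *\<^sub>R a + 1 *\<^sub>R n" by (simp add: V0_def P0_def)
  then have "(dist V0 P0)\<^sup>2 = 4 / 3" using coords[of k "1"] k2 by (simp add: dist_norm)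
  ultimately have sides: "dist P0 Q0 = 2 * k" "dist Q0 V0 = 2 * k" "dist V0 P0 = 2 * k"
    unfolding k4[symmetric] by (metis real_sqrt_unique zero_le_dist)+
  have eq: "equilateral_triangle (2 * sqrt 3) (convex hull {P0, Q0, V0})"
    unfolding equilateral_triangle_def
    by (rule exI[of _ P0], rule exI[of _ Q0], rule exI[of _ V0]) (simp add: sides k_def)
  \<comment> \<open>The square of \<open>8 / 5\<close> exceeds the constant \<open>12 / 5\<close> in the bound for \<open>x\<^sup>2\<close> by enough to absorb
    terms of order \<open>\<epsilon>\<^sup>2\<close>.\<close>
  define \<eta> where "\<eta> = 8 / 5 * sqrt \<epsilon>"
  have \<eta>2: "\<eta>\<^sup>2 = 64 / 25 * \<epsilon>" using \<epsilon> by (simp add: \<eta>_def power_mult_distrib power2_eq_square)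
  have \<eta>0: "0 \<le> \<eta>" using \<epsilon> by (simp add: \<eta>_def)
  have e2: "\<epsilon>\<^sup>2 \<le> \<epsilon> / 384"
    using mult_left_mono[of \<epsilon> "1 / 384" \<epsilon>] \<epsilon> by (simp add: power2_eq_square)
  have near_foot: "\<bar>w / 2 - k\<bar> \<le> \<eta>"
  proof (rule power2_le_imp_le[OF _ \<eta>0])
    have "\<bar>w / 2 - k\<bar>\<^sup>2 \<le> (2 / 3 * \<epsilon>)\<^sup>2"
      using est(1)[OF w0] by (intro power_mono) (auto simp: k_def)
    also have "\<dots> \<le> \<eta>\<^sup>2" using e2 \<epsilon> by (simp add: \<eta>2 power_mult_distrib power_divide)
    finally show "\<bar>w / 2 - k\<bar>\<^sup>2 \<le> \<eta>\<^sup>2" .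
  qed
  have norm_a: "norm a = 1" using frame(1) by (simp add: norm_eq_1)
  have nP: "dist P P0 \<le> \<eta>"
  proof -
    have "P - P0 = (k - w / 2) *\<^sub>R a" by (simp add: P P0_def algebra_simps)
    then show ?thesis using near_foot norm_a by (simp add: dist_norm abs_minus_commute)
  qed
  have nQ: "dist Q Q0 \<le> \<eta>"
  proof -
    have "Q - Q0 = (w / 2 - k) *\<^sub>R a" by (simp add: Q Q0_def algebra_simps)
    then show ?thesis using near_foot norm_a by (simp add: dist_norm)
  qed
  have nV: "dist V V0 \<le> \<eta>"
  proof (rule power2_le_imp_le[OF _ \<eta>0])
    have "V - V0 = x *\<^sub>R a + (h - 1) *\<^sub>R n" by (simp add: V V0_def algebra_simps)
    then have "(dist V V0)\<^sup>2 = x\<^sup>2 + (h - 1)\<^sup>2" by (metis coords dist_norm)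
    also have "\<dots> \<le> 12 / 5 * \<epsilon> + \<epsilon>\<^sup>2"
      using est(2,3)[OF w0] h1 by (intro add_mono power_mono) auto
    also have "\<dots> \<le> \<eta>\<^sup>2" using e2 \<epsilon> by (simp add: \<eta>2)
    finally show "(dist V V0)\<^sup>2 \<le> \<eta>\<^sup>2" .
  qed
  \<comment> \<open>Neither the excess over the chord nor the sum with the chord is larger for one of the two arcs
    than for both arcs together.\<close>
  have excess: "d\<^sup>2 - \<delta>\<^sup>2 \<le> 7 * \<epsilon>"
    if "\<delta> \<le> d" "0 \<le> \<delta>" "0 \<le> \<delta>'" "\<delta>' \<le> d'" "d + d' = l + \<tau>" "\<delta> + \<delta>' = dist P V + dist V Q" for d \<delta> d' \<delta>'
  proof -
    have "(d - \<delta>) * (d + \<delta>) \<le> ((d + d') - (\<delta> + \<delta>')) * ((d + d') + (\<delta> + \<delta>'))"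
      using that(1-4) by (intro mult_mono) auto
    also have "\<dots> = (l + \<tau>)\<^sup>2 - (dist P V + dist V Q)\<^sup>2"
      unfolding that(5,6) by (simp add: power2_eq_square algebra_simps)
    also have "\<dots> \<le> 7 * \<epsilon>" by (rule est(4)[OF w0])
    finally show ?thesis by (simp add: power2_eq_square algebra_simps)
  qed
  have s1: "(X t - X s)\<^sup>2 - (dist P V)\<^sup>2 \<le> 7 * \<epsilon>"
    by (rule excess[OF d1 _ _ d2]) (auto simp: \<tau>_def)
  have s2: "(X (s + 2 * l) - X t)\<^sup>2 - (dist V Q)\<^sup>2 \<le> 7 * \<epsilon>"
    by (rule excess[OF d2 _ _ d1]) (auto simp: \<tau>_def)
  have s3: "(X s + 2 * l - X (s + 2 * l))\<^sup>2 - (dist P Q)\<^sup>2 \<le> 7 * \<epsilon>"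
    using est(5)[OF w0] by (simp add: PQ \<tau>_def algebra_simps)
  have "sqrt (7 * \<epsilon> / 4) \<le> 7 / 5 * sqrt \<epsilon>"
    using \<epsilon> by (intro real_le_lsqrt) (auto simp: power_mult_distrib power2_eq_square)
  then have \<rho>: "sqrt (7 * \<epsilon> / 4) + \<eta> \<le> 3 * sqrt \<epsilon>" by (simp add: \<eta>_def)
  note near = surface_near_triangle[OF st strict nP[unfolded P_def] nQ[unfolded Q_def] nV[unfolded V_def]
      s1[unfolded P_def V_def] s2[unfolded Q_def V_def] s3[unfolded P_def Q_def] \<rho>]
  show thesis by (rule that[OF eq near])
qed

end

section \<open>Bends of an embedded paper Moebius band\<close>

context moebius_lift
begin

lemma straight_affine:
  assumes "straight a a'" "0 \<le> y" "y \<le> 1"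
  shows "F (chord_point a a' y) = (1 - y) *\<^sub>R F (a, 0) + y *\<^sub>R F (a', 1)"
proof -
  let ?d = "dist (a, 0::real) (a', 1)"
  have "chord_point a a' y - (a, 0) = y *\<^sub>R ((a', 1) - (a, 0))"
    "chord_point a a' y - (a', 1) = (1 - y) *\<^sub>R ((a, 0) - (a', 1))"
    by (simp_all add: chord_point_def algebra_simps)
  then have "dist (chord_point a a' y) (a, 0) = y * ?d" "dist (chord_point a a' y) (a', 1) = (1 - y) * ?d"
    using assms(2,3) by (simp_all only: dist_norm norm_scaleR norm_minus_commute[of "(a', 1)"] abs_of_nonneg diff_ge_0_iff_ge)
  then have "dist (F (chord_point a a' y)) (F (a, 0)) \<le> y * ?d" "dist (F (chord_point a a' y)) (F (a', 1)) \<le> (1 - y) * ?d"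
    using lipschitz[of "chord_point a a' y" "(a, 0)"] lipschitz[of "chord_point a a' y" "(a', 1)"] assms(2,3)
    by (simp_all add: chord_point_def)
  from arc_near_chord[OF assms(2,3) this, of 0] assms(1)
  show ?thesis by (simp add: straight_def)
qed

definition boundary :: "real \<Rightarrow> real ^ 3" where
  "boundary x = F (x, 0)"

lemma boundary_top: "F (x, 1) = boundary (x + l)"
  using periodic[of 1 x] by (simp add: boundary_def)

lemma F_chord:
  assumes "0 \<le> y" "y \<le> 1"
  shows "F (chord_point (bend_pos s) (s - bend_pos s) y) =
    (1 - y) *\<^sub>R boundary (bend_pos s) + y *\<^sub>R boundary (bend_pos (s + 2 * l))"
  using straight_affine[OF bend_straight assms, of s] by (simp add: boundary_top bend_pos_glide) (simp add: boundary_def)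

sublocale bend_family l boundary bend_pos
proof
  show "0 < l" by (rule l_pos)
  show "dist (boundary x) (boundary y) \<le> \<bar>x - y\<bar>" for x y
    using lipschitz[of "(x, 0)" "(y, 0)"] by (simp add: boundary_def dist_Pair_Pair dist_real_def)
  show "boundary (x + 2 * l) = boundary x" for x
    using periodic[of 0 x] boundary_top[of "x + l"] by (simp add: boundary_def add.assoc)
  show "s \<le> t \<Longrightarrow> bend_pos s \<le> bend_pos t" "s \<le> t \<Longrightarrow> s - bend_pos s \<le> t - bend_pos t" for s t
    by (rule bend_pos_mono bend_pos_mono'; assumption)+
  show "bend_pos (s + 2 * l) = s - bend_pos s + l" for s by (rule bend_pos_glide)
  show "(dist (boundary (bend_pos s)) (boundary (bend_pos (s + 2 * l))))\<^sup>2
      = 1 + (bend_pos (s + 2 * l) - bend_pos s - l)\<^sup>2" for s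
  proof -
    have "dist (boundary (bend_pos s)) (boundary (bend_pos (s + 2 * l))) = dist (bend_pos s, 0::real) (s - bend_pos s, 1)"
      using bend_straight[of s] by (simp add: straight_def boundary_top bend_pos_glide) (simp add: boundary_def)
    then show ?thesis
      by (simp add: dist_Pair_Pair dist_real_def bend_pos_glide power2_commute)
  qed
qed

text \<open>At a fixed height the position of the bend depends continuously on its parameter and is unbounded in
both directions.\<close>

lemma chord_through:
  assumes "0 \<le> y"  "y \<le> 1"
  shows "\<exists>s. (x, y) = chord_point (bend_pos s) (s - bend_pos s) y"
proof -
  define g where "g s = (1 - y) * bend_pos s + y * (s - bend_pos s)" for s
  have cont: "continuous_on S g" for S
    unfolding g_def by (intro continuous_intros continuous_on_X)
  have shift: "g (s + real n * (4 * l)) = g s + real n * (2 * l)" for s n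
  proof (induction n)
    case (Suc n)
    have step: "g (u + 4 * l) = g u + 2 * l" for u
    proof -
      have "u + 4 * l = u + 2 * l + 2 * l" by simp
      then have "bend_pos (u + 4 * l) = bend_pos u + 2 * l" by (simp only: X_two_turns)
      then show ?thesis by (simp add: g_def algebra_simps)
    qed
    show ?case using step[of "s + real n * (4 * l)"] Suc by (simp add: algebra_simps)
  qed simp
  obtain n :: nat where n: "\<bar>x - g 0\<bar> < real n * (2 * l)"
    using ex_less_of_nat_mult[of "2 * l" "\<bar>x - g 0\<bar>"] l_pos by auto
  have "g (real n * (4 * l)) = g 0 + real n * (2 * l)" "g 0 = g (- (real n * (4 * l))) + real n * (2 * l)"
    using shift[of 0 n] shift[of "- (real n * (4 * l))" n] by simp_all
  then have "g (- (real n * (4 * l))) \<le> x" "x \<le> g (real n * (4 * l))"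
    using n by linarith+
  moreover have "- (real n * (4 * l)) \<le> real n * (4 * l)"
    using l_pos by simp
  ultimately obtain s where "g s = x"
    using IVT'[of g "- (real n * (4 * l))" x "real n * (4 * l)"] cont by blast
  then show ?thesis by (auto simp: chord_point_def g_def)
qed

lemma surface_eq: "surface = F ` strip"
proof (rule subset_antisym)
  have bdry: "boundary x \<in> F ` strip" for x by (auto simp: boundary_def intro!: imageI)
  have "(1 - y) *\<^sub>R boundary (bend_pos s) + y *\<^sub>R boundary (bend_pos (s + 2 * l)) \<in> F ` strip"
    if "0 \<le> y" "y \<le> 1" for s y
    unfolding F_chord[OF that, symmetric] using that by (intro imageI) (simp add: chord_point_def)
  then show "surface \<subseteq> F ` strip" using bdry by (auto simp: surface_def in_segment)
  show "F ` strip \<subseteq> surface"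
  proof
    fix z assume "z \<in> F ` strip"
    then obtain x y where xy: "0 \<le> y" "y \<le> 1" "z = F (x, y)" by auto
    then obtain s where "(x, y) = chord_point (bend_pos s) (s - bend_pos s) y" using chord_through by blast
    then show "z \<in> surface"
      using F_chord[OF xy(1,2), of s] xy by (auto simp: surface_def in_segment)
  qed
qed

lemma chords_through_common_point:
  assumes y: "0 < y" "y < 1"
    and eq: "chord_point (bend_pos s) (s - bend_pos s) y = chord_point (bend_pos t) (t - bend_pos t) y"
  shows "s = t"
proof -
  have *: "s = t" if "s \<le> t" "(1 - y) * (bend_pos t - bend_pos s) + y * ((t - bend_pos t) - (s - bend_pos s)) = 0" for s t
  proof -
    have "0 \<le> bend_pos t - bend_pos s" "0 \<le> (t - bend_pos t) - (s - bend_pos s)"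
      using bend_pos_mono[OF that(1)] bend_pos_mono'[OF that(1)] by auto
    then have "(1 - y) * (bend_pos t - bend_pos s) = 0 \<and> y * ((t - bend_pos t) - (s - bend_pos s)) = 0"
      using that(2) y by (intro add_nonneg_eq_0_iff[THEN iffD1]) auto
    then show ?thesis using y by simp
  qed
  have "(1 - y) * bend_pos s + y * (s - bend_pos s) = (1 - y) * bend_pos t + y * (t - bend_pos t)"
    using eq by (simp add: chord_point_def)
  then show ?thesis
    using *[of s t] *[of t s] by (cases "s \<le> t") (auto simp: algebra_simps)
qed

lemma glide_chord:
  "(glide l ^^ n) (chord_point (bend_pos s) (s - bend_pos s) y) =
    chord_point (bend_pos (s + real n * (2 * l))) (s + real n * (2 * l) - bend_pos (s + real n * (2 * l)))
      (if even n then y else 1 - y)"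
proof (induction n)
  case (Suc n)
  define u where "u = s + real n * (2 * l)"
  have u: "s + real (Suc n) * (2 * l) = u + 2 * l" by (simp add: u_def algebra_simps)
  have "glide l (chord_point (bend_pos u) (u - bend_pos u) z) =
      chord_point (bend_pos (u + 2 * l)) (u + 2 * l - bend_pos (u + 2 * l)) (1 - z)" for z
    unfolding bend_pos_glide by (simp add: glide_def chord_point_def algebra_simps)
  then show ?case using Suc.IH unfolding u u_def[symmetric] by simp
qed simp

lemma direction_turns: "direction (s + real n * (2 * l)) = direction s \<or> direction (s + real n * (2 * l)) = - direction s"
proof (induction n)
  case (Suc n)
  have e: "s + real (Suc n) * (2 * l) = s + real n * (2 * l) + 2 * l" by (simp add: algebra_simps)
  show ?case unfolding e direction_glide using Suc by auto
qed simp

text \<open>Points of the strip with the same image lie in one orbit, so some iterate of the glide reflection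
carries one bend to a bend that meets the other in an interior point of the strip. Both belong to the same
monotone family, so they are equal, and each turn only reverses the direction.\<close>

lemma embedded_bend_familyI:
  assumes inj: "\<And>p q. \<lbrakk>p \<in> strip; q \<in> strip; F p = F q\<rbrakk> \<Longrightarrow> (p, q) \<in> orbit_rel l"
  shows "embedded_bend_family l boundary bend_pos"
proof unfold_locales
  have iterate: "direction t = direction s \<or> direction t = - direction s"
    if "0 < y" "y < 1" "0 < z" "z < 1"
      "chord_point (bend_pos t) (t - bend_pos t) z = (glide l ^^ n) (chord_point (bend_pos s) (s - bend_pos s) y)" for s t y z n
  proof -
    have z: "z = (if even n then y else 1 - y)"
      using that(5) unfolding glide_chord by (simp add: chord_point_def)
    have "t = s + real n * (2 * l)"
      by (rule chords_through_common_point[OF that(3,4)]) (use that(5) glide_chord z in simp)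
    then show ?thesis using direction_turns by simp
  qed
  fix y z s t :: real
  assume yz: "0 < y" "y < 1" "0 < z" "z < 1"
  assume "boundary (bend_pos s) + y *\<^sub>R direction s = boundary (bend_pos t) + z *\<^sub>R direction t"
  then have "F (chord_point (bend_pos s) (s - bend_pos s) y) = F (chord_point (bend_pos t) (t - bend_pos t) z)"
    using yz by (simp add: F_chord direction_def algebra_simps)
  from inj[OF _ _ this] yz
  have "(chord_point (bend_pos s) (s - bend_pos s) y, chord_point (bend_pos t) (t - bend_pos t) z) \<in> orbit_rel l"
    by (simp add: chord_point_def)
  then consider n where "chord_point (bend_pos t) (t - bend_pos t) z = (glide l ^^ n) (chord_point (bend_pos s) (s - bend_pos s) y)"
    | n where "chord_point (bend_pos s) (s - bend_pos s) y = (glide l ^^ n) (chord_point (bend_pos t) (t - bend_pos t) z)"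
    by (auto simp: orbit_rel_def)
  then show "direction t = direction s \<or> direction t = - direction s"
  proof cases
    case 1
    then show ?thesis using iterate yz by blast
  next
    case 2
    then have "direction s = direction t \<or> direction s = - direction t" using iterate yz by blast
    then show ?thesis by auto
  qed
qed

end

lemma orbit_rel_refl: "p \<in> strip \<Longrightarrow> (p, p) \<in> orbit_rel l"
  unfolding orbit_rel_def by (auto intro: exI[of _ 0])

lemma glide_in_strip: "p \<in> strip \<Longrightarrow> glide l p \<in> strip"
  by (cases p) (simp add: glide_def)

lemma moebius_proj_glide:
  assumes p: "p \<in> strip"
  shows "moebius_proj l (glide l p) = moebius_proj l p"
proof -
  have inj: "glide l x = glide l y \<Longrightarrow> x = y" for x y by (auto simp: glide_def split: prod.splits)
  have "(glide l p, q) \<in> orbit_rel l \<longleftrightarrow> (p, q) \<in> orbit_rel l" for q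
  proof
    assume "(glide l p, q) \<in> orbit_rel l"
    then obtain n where q: "q \<in> strip" and n: "q = (glide l ^^ n) (glide l p) \<or> glide l p = (glide l ^^ n) q"
      by (auto simp: orbit_rel_def)
    have "\<exists>n. q = (glide l ^^ n) p \<or> p = (glide l ^^ n) q"
      using n
    proof
      assume "q = (glide l ^^ n) (glide l p)"
      then have "q = (glide l ^^ Suc n) p" by (simp add: funpow_swap1)
      then show ?thesis by blast
    next
      assume eq: "glide l p = (glide l ^^ n) q"
      show ?thesis
      proof (cases n)
        case 0
        then have "q = (glide l ^^ 1) p" using eq by simp
        then show ?thesis by blast
      next
        case (Suc m)
        then have "p = (glide l ^^ m) q" using eq inj by simp
        then show ?thesis by blast
      qed
    qed
    then show "(p, q) \<in> orbit_rel l" using p q by (auto simp: orbit_rel_def)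
  next
    assume "(p, q) \<in> orbit_rel l"
    then obtain n where q: "q \<in> strip" and n: "q = (glide l ^^ n) p \<or> p = (glide l ^^ n) q"
      by (auto simp: orbit_rel_def)
    have "\<exists>n. q = (glide l ^^ n) (glide l p) \<or> glide l p = (glide l ^^ n) q"
      using n
    proof
      assume eq: "q = (glide l ^^ n) p"
      show ?thesis
      proof (cases n)
        case 0
        then have "glide l p = (glide l ^^ 1) q" using eq by simp
        then show ?thesis by blast
      next
        case (Suc m)
        then have "q = (glide l ^^ m) (glide l p)" using eq by (simp add: funpow_swap1)
        then show ?thesis by blast
      qed
    next
      assume "p = (glide l ^^ n) q"
      then have "glide l p = (glide l ^^ Suc n) q" by simp
      then show ?thesis by blast
    qed
    then show "(glide l p, q) \<in> orbit_rel l" using p q glide_in_strip[OF p] by (auto simp: orbit_rel_def)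
  qed
  then show ?thesis by (auto simp: moebius_proj_def)
qed

lemma moebius_proj_eq_imp: "q \<in> strip \<Longrightarrow> moebius_proj l p = moebius_proj l q \<Longrightarrow> (p, q) \<in> orbit_rel l"
  unfolding moebius_proj_def using orbit_rel_refl[of q l] by blast

lemma isometric_imp_lipschitz:
  assumes "riemannian_isometric_on S f" "convex S" "p \<in> S" "q \<in> S"
  shows "dist (f p) (f q) \<le> dist p q"
proof -
  obtain D where D: "\<And>x. x \<in> S \<Longrightarrow> (f has_derivative D x) (at x within S)"
    "\<And>x v w. x \<in> S \<Longrightarrow> D x v \<bullet> D x w = v \<bullet> w"
    using assms(1) unfolding riemannian_isometric_on_def by metis
  have "onorm (D x) \<le> 1" if "x \<in> S" for x
    by (rule onorm_le) (simp add: norm_eq_sqrt_inner D(2)[OF that])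
  from differentiable_bound[OF assms(2) D(1) this assms(3,4)]
  show ?thesis by (simp add: dist_norm)
qed

lemma moebius_lift_paper_band:
  assumes "paper_moebius_band l I"
  shows "moebius_lift l (I \<circ> moebius_proj l)"
proof
  let ?F = "I \<circ> moebius_proj l"
  have iso: "riemannian_isometric_on strip ?F" and sm: "smooth_on strip ?F"
    using assms by (auto simp: paper_moebius_band_def)
  show "0 < l" using assms by (simp add: paper_moebius_band_def)
  show "smooth_in open_strip ?F"
    by (rule smooth_on_imp_smooth_in[OF open_open_strip open_strip_subset sm])
  show "dist (?F p) (?F q) \<le> dist p q" if "p \<in> strip" "q \<in> strip" for p q
    by (rule isometric_imp_lipschitz[OF iso _ that]) (simp add: strip_def convex_Times)
  show "?F (x + l, 1 - y) = ?F (x, y)" if "0 \<le> y" "y \<le> 1" for x y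
    using moebius_proj_glide[of "(x, y)" l] that by (simp add: glide_def)
  show "dderiv v ?F p \<bullet> dderiv w ?F p = v \<bullet> w" if p: "p \<in> open_strip" for p v w
  proof -
    obtain D where D: "(?F has_derivative D) (at p within strip)" "\<And>v w. D v \<bullet> D w = v \<bullet> w"
      using iso p open_strip_subset unfolding riemannian_isometric_on_def by blast
    have "(?F has_derivative D) (at p within open_strip)"
      by (rule has_derivative_subset[OF D(1) open_strip_subset])
    then have "(?F has_derivative D) (at p)"
      using at_within_open[OF p open_open_strip] by simp
    then show ?thesis using D(2) by (simp add: dderiv_unique)
  qed
qed

lemma hausdorff_distance_le:
  assumes "0 \<le> r" "\<And>a. a \<in> A \<Longrightarrow> \<exists>b\<in>B. dist b a \<le> r" "\<And>b. b \<in> B \<Longrightarrow> \<exists>a\<in>A. dist b a \<le> r"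
  shows "hausdorff_distance A B \<le> r"
  unfolding hausdorff_distance_def
proof (rule cInf_lower)
  show "r \<in> {r. 0 \<le> r \<and> A \<subseteq> closed_tube B r \<and> B \<subseteq> closed_tube A r}"
    using assms by (force simp: closed_tube_def dist_commute)
qed (auto intro: bdd_belowI[of _ 0])

theorem corollary1p3:
  fixes \<epsilon> l :: real and I :: "(real \<times> real) set \<Rightarrow> real ^ 3"
  assumes "0 < \<epsilon>" and "\<epsilon> < 1 / 384"
    and "paper_moebius_band l I"
    and "l < sqrt 3 + \<epsilon>"
  shows "\<exists>T :: (real ^ 3) set. equilateral_triangle (2 * sqrt 3) T \<and>
           hausdorff_distance T (I ` moebius_band l) \<le> 18 * sqrt \<epsilon>"
proof -
  let ?F = "I \<circ> moebius_proj l"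
  interpret moebius_lift l ?F by (rule moebius_lift_paper_band[OF assms(3)])
  have "inj_on I (moebius_band l)"
    using assms(3) homeomorphic_imp_injective_map
    by (fastforce simp: paper_moebius_band_def embedding_map_def)
  then have inj: "(p, q) \<in> orbit_rel l" if "p \<in> strip" "q \<in> strip" "?F p = ?F q" for p q
    using that moebius_proj_eq_imp[of q l p] by (auto simp: moebius_band_eq inj_on_def)
  interpret embedded_bend_family l boundary bend_pos
    by (rule embedded_bend_familyI[OF inj])
  obtain T where T: "equilateral_triangle (2 * sqrt 3) T"
    "\<And>z. z \<in> surface \<Longrightarrow> \<exists>n\<in>T. dist z n \<le> 3 * sqrt \<epsilon>"
    "\<And>n. n \<in> T \<Longrightarrow> \<exists>z\<in>surface. dist z n \<le> 3 * sqrt \<epsilon>"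
    using near_equilateral_triangle[OF assms(1,2,4)] by blast
  have surf: "surface = I ` moebius_band l"
    by (simp add: surface_eq moebius_band_eq image_comp)
  have le: "3 * sqrt \<epsilon> \<le> 18 * sqrt \<epsilon>" using assms(1) by simp
  have "hausdorff_distance T (I ` moebius_band l) \<le> 18 * sqrt \<epsilon>"
    unfolding surf[symmetric]
  proof (rule hausdorff_distance_le)
    show "0 \<le> 18 * sqrt \<epsilon>" using assms(1) by simp
    show "\<exists>b\<in>surface. dist b a \<le> 18 * sqrt \<epsilon>" if "a \<in> T" for a
      using T(3)[OF that] le by (meson order_trans)
    show "\<exists>a\<in>T. dist b a \<le> 18 * sqrt \<epsilon>" if "b \<in> surface" for b
      using T(2)[OF that] le by (meson order_trans)
  qed
  then show ?thesis using T(1) by blast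
qed

end
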